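(* For every $n\ge0$, the genus polynomial of the iterated claw $Y_n$ is $$\Gamma_{Y_n}(z)=2^{n-1}\bigl(h_{n+1}(z)+2(2-3z)h_n(z)-6z\,h_{n-1}(z)\bigr),$$ where for every integer $m$ $$h_m(z)=\sum_{\substack{j,i_1,i_2,i_3\ge0\\ 2j+i_1+i_2+i_3=m}}\binom{j+i_1}{i_1}\binom{j+i_2}{i_2}\binom{j+i_3}{i_3}(1+\sqrt3)^{i_2}(1-\sqrt3)^{i_3}\,3^{j+i_1}(2z)^{m-j}$$ (an empty sum, e.g. for $m<0$, being $0$).
   Context: All embeddings are cellular embeddings in closed orientable surfaces, counted up to combinatorial equivalence (distinct rotation systems counted as distinct). The genus polynomial of a connected graph $G$ is $\Gamma_G(z)=\sum_{i\ge0}g_i(G)z^i$, where $g_i(G)$ is the number of embeddings of $G$ in the orientable surface of genus $i$. The iterated claws $Y_n$ are defined by: $Y_0$ is the dipole $D_3$ (two vertices joined by three parallel edges) with root $u_0$ one of its vertices; for $n\ge1$, $Y_n$ (with root $u_n$) is obtained from $Y_{n-1}$ by subdividing each of the three edges incident on the root $u_{n-1}$ and joining the three new vertices to a new vertex $u_n$. *)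

theory Defs
  imports
    "Graph_Theory.Graph_Theory"
    "HOL-Combinatorics.Orbits"
    "HOL-Computational_Algebra.Polynomial"
    Complex_Main
begin

section \<open>Cellular embeddings as rotation systems\<close>

text \<open>
  An undirected multigraph is a \<^locale>\<open>bidirected_digraph\<close>: every edge contributes two
  arcs, one for each direction, exchanged by the involution \<open>arev\<close>.
  Combinatorial equivalence classes of cellular embeddings in closed oriented surfaces are
  rotation systems: a permutation of the arcs that, at each vertex, cyclically permutes
  the arcs leaving that vertex.
\<close>

definition rotation_system :: "('v, 'e) pre_digraph \<Rightarrow> ('e \<Rightarrow> 'e) \<Rightarrow> bool" where
  "rotation_system G \<rho> \<longleftrightarrow>
     \<rho> permutes arcs G \<and>
     (\<forall>v\<in>verts G. out_arcs G v \<noteq> {} \<longrightarrow> cyclic_on \<rho> (out_arcs G v))"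

definition faces :: "('v, 'e) pre_digraph \<Rightarrow> ('e \<Rightarrow> 'e) \<Rightarrow> ('e \<Rightarrow> 'e) \<Rightarrow> 'e set set" where
  "faces G arev \<rho> = orbit (\<rho> \<circ> arev) ` arcs G"

definition euler_characteristic ::
    "('v, 'e) pre_digraph \<Rightarrow> ('e \<Rightarrow> 'e) \<Rightarrow> ('e \<Rightarrow> 'e) \<Rightarrow> int" where
  "euler_characteristic G arev \<rho> =
     int (card (verts G)) - int (card (arcs G) div 2) + int (card (faces G arev \<rho>))"

text \<open>
  The following two definitions are meant for connected \<open>G\<close> with at least one edge, where
  the surface carrying the embedding is connected and has genus \<open>g\<close> iff its Euler
  characteristic is \<open>2 - 2 * g\<close>.
\<close>

definition embeddings_of_genus ::
    "('v, 'e) pre_digraph \<Rightarrow> ('e \<Rightarrow> 'e) \<Rightarrow> nat \<Rightarrow> ('e \<Rightarrow> 'e) set" where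
  "embeddings_of_genus G arev g =
     {\<rho>. rotation_system G \<rho> \<and> euler_characteristic G arev \<rho> = 2 - 2 * int g}"

definition genus_polynomial :: "('v, 'e) pre_digraph \<Rightarrow> ('e \<Rightarrow> 'e) \<Rightarrow> real poly" where
  "genus_polynomial G arev =
     (\<Sum>g | embeddings_of_genus G arev g \<noteq> {}.
        monom (real (card (embeddings_of_genus G arev g))) g)"

lemma coeff_genus_polynomial:
  assumes "finite (arcs G)"
  shows "coeff (genus_polynomial G arev) g = real (card (embeddings_of_genus G arev g))"
proof -
  let ?E = "embeddings_of_genus G arev"
  have fin: "finite (\<Union>g. ?E g)"
    by (rule finite_subset[OF _ finite_permutations[OF assms]])
      (auto simp: embeddings_of_genus_def rotation_system_def)
  have "{g. ?E g \<noteq> {}} \<subseteq> (\<lambda>\<rho>. THE g. \<rho> \<in> ?E g) ` (\<Union>g. ?E g)"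
  proof
    fix g assume "g \<in> {g. ?E g \<noteq> {}}"
    then obtain \<rho> where \<rho>: "\<rho> \<in> ?E g" by blast
    then have "(THE g. \<rho> \<in> ?E g) = g"
      by (auto simp: embeddings_of_genus_def)
    with \<rho> show "g \<in> (\<lambda>\<rho>. THE g. \<rho> \<in> ?E g) ` (\<Union>g. ?E g)"
      by (intro image_eqI[where x = \<rho>]) auto
  qed
  with fin have "finite {g. ?E g \<noteq> {}}"
    by (meson finite_imageI finite_subset)
  then show ?thesis
    by (simp add: genus_polynomial_def coeff_sum)
qed

section \<open>Iterated claws\<close>

text \<open>
  Arcs are triples of tail, head and a label; labels separate the parallel edges of the dipole.
\<close>

type_synonym 'v larc = "'v \<times> 'v \<times> nat"

definition arc_swap :: "'v larc \<Rightarrow> 'v larc" where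
  "arc_swap = (\<lambda>(u, v, i). (v, u, i))"

definition arc_rev :: "('v, 'v larc) pre_digraph \<Rightarrow> 'v larc \<Rightarrow> 'v larc" where
  "arc_rev G a = (if a \<in> arcs G then arc_swap a else a)"

definition edge :: "'v \<Rightarrow> 'v \<Rightarrow> nat \<Rightarrow> 'v larc set" where
  "edge u v i = {(u, v, i), (v, u, i)}"

definition lgraph :: "'v set \<Rightarrow> 'v larc set \<Rightarrow> ('v, 'v larc) pre_digraph" where
  "lgraph V A = \<lparr>verts = V, arcs = A, tail = fst, head = fst \<circ> snd\<rparr>"

text \<open>
  Every edge at \<open>u\<close> (the label \<open>i\<close> identifies it among the edges at \<open>u\<close>) is
  subdivided by the vertex \<open>x i\<close>, and all these vertices are joined to the vertex \<open>u'\<close>.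
\<close>

definition add_claw ::
    "'v \<Rightarrow> (nat \<Rightarrow> 'v) \<Rightarrow> 'v \<Rightarrow> ('v, 'v larc) pre_digraph \<Rightarrow> ('v, 'v larc) pre_digraph" where
  "add_claw u x u' G =
     lgraph
       (verts G \<union> {x i | i w. (u, w, i) \<in> out_arcs G u} \<union> {u'})
       ((arcs G - out_arcs G u - in_arcs G u) \<union>
        (\<Union>(_, w, i)\<in>out_arcs G u. edge u (x i) i \<union> edge (x i) w i \<union> edge (x i) u' i))"

datatype claw_vertex = Base | Root nat | Subdiv nat nat

primrec iterated_claw :: "nat \<Rightarrow> (claw_vertex, claw_vertex larc) pre_digraph" where
  "iterated_claw 0 = lgraph {Base, Root 0} (\<Union>i\<in>{0, 1, 2}. edge (Root 0) Base i)"
| "iterated_claw (Suc n) = add_claw (Root n) (Subdiv (Suc n)) (Root (Suc n)) (iterated_claw n)"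

lemma iterated_claw_tail_head:
  "tail (iterated_claw n) = fst" "head (iterated_claw n) = fst \<circ> snd"
  by (cases n; simp add: lgraph_def add_claw_def)+

lemma iterated_claw_invariant:
  defines "nb \<equiv> \<lambda>n i. if n = 0 then Base else Subdiv n i"
  shows "finite (verts (iterated_claw n)) \<and> finite (arcs (iterated_claw n)) \<and>
    verts (iterated_claw n) \<subseteq> {Base} \<union> Root ` {..n} \<union> (\<lambda>(k, i). Subdiv k i) ` ({..n} \<times> UNIV) \<and>
    Root n \<in> verts (iterated_claw n) \<and>
    out_arcs (iterated_claw n) (Root n) = (\<lambda>i. (Root n, nb n i, i)) ` {0, 1, 2} \<and>
    (\<forall>u v i. (u, v, i) \<in> arcs (iterated_claw n) \<longrightarrow> u \<noteq> v \<and> u \<in> verts (iterated_claw n) \<and>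
       (v, u, i) \<in> arcs (iterated_claw n)) \<and>
    (\<forall>v\<in>verts (iterated_claw n). (Root n, v) \<in> (arcs_ends (iterated_claw n))\<^sup>*)"
proof (induction n)
  case 0
  show ?case
    by (auto simp: nb_def lgraph_def edge_def out_arcs_def arcs_ends_def arc_to_ends_def)
next
  case (Suc n)
  let ?G = "iterated_claw n" and ?H = "iterated_claw (Suc n)"
  let ?x = "Subdiv (Suc n)" and ?u = "Root n" and ?u' = "Root (Suc n)"
  have fin: "finite (verts ?G)" "finite (arcs ?G)"
    and V: "verts ?G \<subseteq> {Base} \<union> Root ` {..n} \<union> (\<lambda>(k, i). Subdiv k i) ` ({..n} \<times> UNIV)"
    and root: "?u \<in> verts ?G"
    and out: "out_arcs ?G ?u = (\<lambda>i. (?u, nb n i, i)) ` {0, 1, 2}"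
    and arc: "\<And>u v i. (u, v, i) \<in> arcs ?G \<Longrightarrow> u \<noteq> v \<and> u \<in> verts ?G \<and> (v, u, i) \<in> arcs ?G"
    and conn: "\<And>v. v \<in> verts ?G \<Longrightarrow> (?u, v) \<in> (arcs_ends ?G)\<^sup>*"
    using Suc.IH by auto
  have nb: "(?u, nb n i, i) \<in> arcs ?G" if "i \<in> {0, 1, 2}" for i
    using out that unfolding out_arcs_def by blast
  have mem: "(u, v, i) \<in> arcs ?G \<Longrightarrow> u = ?u \<Longrightarrow> i \<in> {0, 1, 2} \<and> v = nb n i" for u v i
  proof -
    assume "(u, v, i) \<in> arcs ?G" "u = ?u"
    then have "(u, v, i) \<in> out_arcs ?G ?u"
      by (simp add: out_arcs_def iterated_claw_tail_head)
    then show ?thesis unfolding out by auto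
  qed
  have VH: "verts ?H = verts ?G \<union> ?x ` {0, 1, 2} \<union> {?u'}"
    by (auto simp: add_claw_def lgraph_def out)
  have AH: "arcs ?H = {(u, v, i) \<in> arcs ?G. u \<noteq> ?u \<and> v \<noteq> ?u} \<union>
      (\<Union>i\<in>{0, 1, 2}. edge ?u (?x i) i \<union> edge (?x i) (nb n i) i \<union> edge (?x i) ?u' i)"
    unfolding iterated_claw.simps(2) add_claw_def out
    by (auto simp: lgraph_def out in_arcs_def iterated_claw_tail_head dest: mem arc)
  have fresh: "?u' \<notin> verts ?G" "\<And>i. ?x i \<notin> verts ?G"
    using V by auto
  have nbV: "nb n i \<in> verts ?G" "nb n i \<noteq> ?u" "(nb n i, ?u, i) \<in> arcs ?G" if "i \<in> {0, 1, 2}" for i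
    using nb[OF that] arc by blast+
  have fresh': "?x i \<noteq> nb n i" "nb n i \<noteq> ?x i" if "i \<in> {0, 1, 2}" for i
    using nbV(1)[OF that] fresh(2)[of i] by metis+
  have 1: "finite (verts ?H)" "finite (arcs ?H)"
  proof -
    show "finite (verts ?H)" unfolding VH using fin by simp
    show "finite (arcs ?H)" unfolding AH
      using fin by (auto simp: edge_def intro: finite_subset[OF _ fin(2)])
  qed
  have 2: "verts ?H \<subseteq> {Base} \<union> Root ` {..Suc n} \<union> (\<lambda>(k, i). Subdiv k i) ` ({..Suc n} \<times> UNIV)"
    unfolding VH using V by force
  have 3: "out_arcs ?H ?u' = (\<lambda>i. (?u', nb (Suc n) i, i)) ` {0, 1, 2}"
  proof -
    have "a \<in> (\<lambda>i. (?u', ?x i, i)) ` {0, 1, 2}" if a: "a \<in> arcs ?H" "fst a = ?u'" for a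
    proof -
      obtain v i where [simp]: "a = (?u', v, i)" using a(2) by (cases a) auto
      from a(1) consider "(?u', v, i) \<in> arcs ?G"
        | i' where "i' \<in> {0, 1, 2}" "(?u', v, i) \<in> edge ?u (?x i') i' \<union> edge (?x i') (nb n i') i' \<union> edge (?x i') ?u' i'"
        unfolding AH by auto
      then show ?thesis
      proof cases
        case 1
        then show ?thesis using arc fresh by blast
      next
        case 2
        then show ?thesis using nbV(1)[OF 2(1)] fresh by (auto simp: edge_def)
      qed
    qed
    moreover have "(?u', ?x i, i) \<in> arcs ?H" if "i \<in> {0, 1, 2}" for i
      unfolding AH using that by (auto simp: edge_def)
    ultimately have "{a \<in> arcs ?H. fst a = ?u'} = (\<lambda>i. (?u', ?x i, i)) ` {0, 1, 2}"
      by (intro equalityI subsetI; clarify?) (blast, auto)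
    then show ?thesis
      unfolding out_arcs_def iterated_claw_tail_head by (simp only: nb_def if_False nat.distinct)
  qed
  have 4: "u \<noteq> v \<and> u \<in> verts ?H \<and> (v, u, i) \<in> arcs ?H" if "(u, v, i) \<in> arcs ?H" for u v i
  proof -
    from that consider "(u, v, i) \<in> arcs ?G" "u \<noteq> ?u" "v \<noteq> ?u"
      | "i \<in> {0, 1, 2}" "(u, v, i) \<in> edge ?u (?x i) i \<union> edge (?x i) (nb n i) i \<union> edge (?x i) ?u' i"
      unfolding AH by (auto simp: edge_def)
    then show ?thesis
    proof cases
      case 1
      then show ?thesis using arc[of u v i] unfolding AH VH by simp
    next
      case 2
      then have "(v, u, i) \<in> edge ?u (?x i) i \<union> edge (?x i) (nb n i) i \<union> edge (?x i) ?u' i"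
        by (auto simp: edge_def)
      with 2 have "(v, u, i) \<in> arcs ?H" unfolding AH by blast
      moreover have "u \<noteq> v" "u \<in> verts ?H"
        unfolding VH using 2 nbV[OF 2(1)] fresh fresh'[OF 2(1)] root by (auto simp: edge_def)
      ultimately show ?thesis by blast
    qed
  qed
  have ends: "arcs_ends (iterated_claw m) = {(u, v). \<exists>i. (u, v, i) \<in> arcs (iterated_claw m)}" for m
    by (force simp: arcs_ends_def arc_to_ends_def iterated_claw_tail_head)
  let ?R = "(arcs_ends ?H)\<^sup>*"
  have R: "(u, v) \<in> ?R" if "(u, v, i) \<in> arcs ?H" for u v i
    using that ends by blast
  have new: "(?u, ?x i) \<in> ?R \<and> (?x i, nb n i) \<in> ?R \<and> (?u', ?x i) \<in> ?R \<and> (?x i, ?u) \<in> ?R \<and>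
      (nb n i, ?x i) \<in> ?R" if i: "i \<in> {0, 1, 2}" for i
  proof -
    have "edge ?u (?x i) i \<union> edge (?x i) (nb n i) i \<union> edge (?x i) ?u' i \<subseteq> arcs ?H"
      unfolding AH using i by blast
    then show ?thesis
      unfolding edge_def by (meson R Un_subset_iff insert_subset)
  qed
  have old: "(u, v) \<in> ?R" if uv: "(u, v, i) \<in> arcs ?G" for u v i
  proof (cases "u = ?u \<or> v = ?u")
    case True
    then show ?thesis
    proof
      assume "u = ?u"
      with mem[OF uv] new[of i] show ?thesis by (auto intro: rtrancl_trans)
    next
      assume "v = ?u"
      with mem[of v u i] arc[OF uv] new[of i] show ?thesis by (auto intro: rtrancl_trans)
    qed
  next
    case False
    then show ?thesis using R[of u v i] uv unfolding AH by simp
  qed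
  have "(arcs_ends ?G)\<^sup>* \<subseteq> ?R"
    using old by (intro rtrancl_subset_rtrancl) (auto simp: ends)
  then have conn': "(?u, v) \<in> ?R" if "v \<in> verts ?G" for v
    using conn that by blast
  have u'u: "(?u', ?u) \<in> ?R"
    using new[of 0] by (auto intro: rtrancl_trans)
  have "(?u', v) \<in> ?R" if v: "v \<in> verts ?H" for v
  proof -
    from v consider "v \<in> verts ?G" | i where "i \<in> {0, 1, 2}" "v = ?x i" | "v = ?u'"
      unfolding VH by blast
    then show ?thesis
      by cases (use u'u conn' new in \<open>blast intro: rtrancl_trans\<close>)+
  qed
  moreover have "?u' \<in> verts ?H" unfolding VH by simp
  ultimately show ?case using 1 2 3 4 by blast
qed

text \<open>The iterated claws are connected multigraphs in the above sense.\<close>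

lemma iterated_claw_arc:
  assumes "(u, v, i) \<in> arcs (iterated_claw n)"
  shows "u \<noteq> v" "u \<in> verts (iterated_claw n)" "(v, u, i) \<in> arcs (iterated_claw n)"
  using iterated_claw_invariant[of n] assms by blast+

lemma fin_digraph_iterated_claw: "fin_digraph (iterated_claw n)"
proof
  show "finite (verts (iterated_claw n))" "finite (arcs (iterated_claw n))"
    using iterated_claw_invariant[of n] by blast+
  fix e assume e: "e \<in> arcs (iterated_claw n)"
  obtain u v i where "e = (u, v, i)" by (cases e)
  then show "tail (iterated_claw n) e \<in> verts (iterated_claw n)"
    "head (iterated_claw n) e \<in> verts (iterated_claw n)"
    using e iterated_claw_arc[of u v i n] iterated_claw_arc[of v u i n]
    by (auto simp: iterated_claw_tail_head)
qed

lemma bidirected_digraph_iterated_claw: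
  "bidirected_digraph (iterated_claw n) (arc_rev (iterated_claw n))"
proof -
  interpret fin_digraph "iterated_claw n" by (rule fin_digraph_iterated_claw)
  show ?thesis
  proof (rule bidirected_digraphI)
    fix a assume a: "a \<in> arcs (iterated_claw n)"
    obtain u v i where "a = (u, v, i)" by (cases a)
    then show "arc_rev (iterated_claw n) a \<noteq> a"
      "arc_rev (iterated_claw n) (arc_rev (iterated_claw n) a) = a"
      "tail (iterated_claw n) (arc_rev (iterated_claw n) a) = head (iterated_claw n) a"
      using a iterated_claw_arc[of u v i n]
      by (auto simp: arc_rev_def arc_swap_def iterated_claw_tail_head)
  qed (simp add: arc_rev_def)
qed

lemma strongly_connected_iterated_claw: "strongly_connected (iterated_claw n)"
proof -
  interpret bidirected_digraph "iterated_claw n" "arc_rev (iterated_claw n)"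
    by (rule bidirected_digraph_iterated_claw)
  have sym: "sym (arcs_ends (iterated_claw n))"
    using iterated_claw_arc(3)[of _ _ _ n]
    by (force simp: sym_def arcs_ends_def arc_to_ends_def iterated_claw_tail_head)
  have "(u, v) \<in> (arcs_ends (iterated_claw n))\<^sup>*"
    if "u \<in> verts (iterated_claw n)" "v \<in> verts (iterated_claw n)" for u v
  proof -
    have "(Root n, u) \<in> (arcs_ends (iterated_claw n))\<^sup>*" "(Root n, v) \<in> (arcs_ends (iterated_claw n))\<^sup>*"
      using that iterated_claw_invariant[of n] by blast+
    then show ?thesis
      using sym_rtrancl[OF sym] by (meson rtrancl_trans symD)
  qed
  then show ?thesis
    using iterated_claw_invariant[of n]
    by (auto simp: strongly_connected_def reachable_conv)
qed

section \<open>The polynomials of the formula\<close>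

abbreviation Z :: "real poly" where "Z \<equiv> [:0, 1:]"

text \<open>The index set is finite and forces \<open>j \<le> m\<close>, so \<open>nat\<close> does not truncate.\<close>

definition h :: "int \<Rightarrow> real poly" where
  "h m = (\<Sum>(j, i1, i2, i3) \<in> {(j, i1, i2, i3). 2 * int j + int i1 + int i2 + int i3 = m}.
     [:real ((j + i1) choose i1) * real ((j + i2) choose i2) * real ((j + i3) choose i3)
       * (1 + sqrt 3) ^ i2 * (1 - sqrt 3) ^ i3 * 3 ^ (j + i1):] * (2 * Z) ^ nat (m - int j))"

end

theory Submission
  imports Defs "HOL-Computational_Algebra.Formal_Power_Series"
begin

text \<open>
  Let the root of \<open>Y\<^sub>n\<close> carry an arbitrary permutation \<open>p\<close> of its three edges instead of a cyclic one, and
  let \<open>P\<^sub>n(p)\<close> be the polynomial counting the rotations at the other vertices by the number of faces.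
  A rotation system of \<open>Y\<^bsub>n+1\<^esub>\<close> with \<open>p\<close> at the new root restricts to one of \<open>Y\<^sub>n\<close>, where the twelve new
  darts are bypassed by the faces: they act as some permutation \<open>q\<close> at the old root, and the faces that
  consist of new darts only are lost. There are sixteen ways to rotate the old root and the three subdivision
  vertices, so \<open>P\<^bsub>n+1\<^esub>(p)\<close> is a sum of sixteen terms \<open>y\<^sup>k P\<^sub>n(q)\<close>, found by a finite computation. It turns out that
  \<open>P\<^sub>n(p)\<close> depends only on the cycle type of \<open>p\<close>. With \<open>E, T, C\<close> for the identity, the transpositions and
  the 3-cycles, \<open>E\<^bsub>n+1\<^esub> = 16 C\<^sub>n\<close>, \<open>T\<^bsub>n+1\<^esub> = 12 T\<^sub>n + 4 y C\<^sub>n\<close> and \<open>C\<^bsub>n+1\<^esub> = 2 E\<^sub>n + 6 y T\<^sub>n + 8 C\<^sub>n\<close>.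
  The generating function of the \<open>h\<^sub>m\<close> is \<open>1 / (1 - 10 z t + (16 z\<^sup>2 - 6 z) t\<^sup>2 + 48 z\<^sup>3 t\<^sup>3)\<close>, and the recurrence it
  encodes shows that these three sequences are explicit combinations of the \<open>h\<^sub>m\<close> once the variable
  counting faces is traded for \<open>z = y\<^bsup>-2\<^esup>\<close>. The face count of \<open>Y\<^sub>n\<close> is \<open>2 C\<^sub>n\<close>.
\<close>

section \<open>Counting cycles by elimination\<close>

definition cycle_count :: "('a \<Rightarrow> 'a) \<Rightarrow> 'a set \<Rightarrow> nat" where
  "cycle_count f A = card (orbit f ` A)"

lemma orbit_subset_closed:
  assumes "f ` A \<subseteq> A" "a \<in> A"
  shows "orbit f a \<subseteq> A"
proof
  fix y assume "y \<in> orbit f a"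
  then show "y \<in> A" by induction (use assms in auto)
qed

text \<open>An \<open>orbit\<close> begins at the image of its point. Since \<open>f\<close> sends
  \<open>insert a (orbit f a)\<close> injectively into \<open>orbit f a\<close>, finiteness forces
  the two sets to coincide.\<close>

lemma inj_self_in_orbit:
  assumes "finite A" "inj_on f A" "f ` A \<subseteq> A" "a \<in> A"
  shows "a \<in> orbit f a"
proof -
  let ?S = "insert a (orbit f a)"
  have S: "?S \<subseteq> A" using orbit_subset_closed[OF assms(3,4)] assms(4) by simp
  have fin: "finite ?S" by (rule finite_subset[OF S assms(1)])
  have sub: "f ` ?S \<subseteq> orbit f a" by (auto intro: orbit.intros)
  moreover have "card (f ` ?S) = card ?S"
    by (rule card_image[OF inj_on_subset[OF assms(2) S]])
  ultimately have "f ` ?S = ?S"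
    using fin by (intro card_subset_eq) auto
  then show ?thesis using sub by blast
qed

lemma cycle_count_cong:
  assumes "f ` A \<subseteq> A" "\<And>x. x \<in> A \<Longrightarrow> f x = g x"
  shows "cycle_count f A = cycle_count g A"
proof -
  have "orbit f x = orbit g x" if x: "x \<in> A" for x
  proof -
    have A: "orbit f x \<subseteq> A" using orbit_subset_closed[OF assms(1) x] .
    show ?thesis
    proof (intro equalityI subsetI)
      fix y assume "y \<in> orbit f x"
      then show "y \<in> orbit g x"
      proof induction
        case base then show ?case using assms(2)[OF x] orbit.base by metis
      next
        case (step y) then show ?case using assms(2)[of y] A orbit.step[of y g x] by auto
      qed
    next
      fix y assume "y \<in> orbit g x"
      then show "y \<in> orbit f x"
      proof induction
        case base then show ?case using assms(2)[OF x] orbit.base by metis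
      next
        case (step y) then show ?case using assms(2)[of y] A orbit.step[of y f x] by auto
      qed
    qed
  qed
  then show ?thesis unfolding cycle_count_def by (metis image_cong)
qed

lemma cycle_count_conj:
  assumes "inj_on e A" "f ` A \<subseteq> A" "\<And>x. x \<in> A \<Longrightarrow> g (e x) = e (f x)"
  shows "cycle_count g (e ` A) = cycle_count f A"
proof -
  have "orbit g (e x) = e ` orbit f x" if x: "x \<in> A" for x
  proof -
    have A: "orbit f x \<subseteq> A" using orbit_subset_closed[OF assms(2) x] .
    have "y \<in> e ` orbit f x" if "y \<in> orbit g (e x)" for y
      using that
    proof induction
      case base show ?case by (simp add: assms(3)[OF x] orbit.base)
    next
      case (step y)
      then obtain z where "z \<in> orbit f x" "y = e z" by blast
      then have "g y = e (f z)" "f z \<in> orbit f x" using A assms(3)[of z] orbit.step[of z f x] by auto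
      then show ?case by simp
    qed
    moreover have "e y \<in> orbit g (e x)" if "y \<in> orbit f x" for y
      using that
    proof induction
      case base show ?case by (simp add: assms(3)[OF x, symmetric] orbit.base)
    next
      case (step y)
      then have "g (e y) = e (f y)" using A assms(3)[of y] by auto
      with orbit.step[OF step(2)] show ?case by simp
    qed
    ultimately show ?thesis by blast
  qed
  then have "orbit g ` e ` A = (\<lambda>X. e ` X) ` orbit f ` A" by (simp add: image_image)
  moreover have "inj_on (\<lambda>X. e ` X) (orbit f ` A)"
    by (rule inj_on_subset[OF inj_on_image_Pow[OF assms(1)]])
      (use orbit_subset_closed[OF assms(2)] in auto)
  ultimately show ?thesis unfolding cycle_count_def by (simp add: card_image)
qed

text \<open>The predecessor of \<open>a\<close> is redirected past it. Every orbit merely loses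
  \<open>a\<close>, and one disappears altogether exactly when \<open>a\<close> was a fixed
  point.\<close>

lemma cycle_count_bypass:
  assumes "finite A" "inj_on f A" "f ` A \<subseteq> A" "a \<in> A"
    and g: "\<And>x. x \<in> A - {a} \<Longrightarrow> g x = (if f x = a then f a else f x)"
  shows "g ` (A - {a}) \<subseteq> A - {a}" "inj_on g (A - {a})"
    "cycle_count f A = cycle_count g (A - {a}) + (if f a = a then 1 else 0)"
proof -
  show closed: "g ` (A - {a}) \<subseteq> A - {a}"
    using g assms(2-4) by (auto simp: inj_on_eq_iff)
  show "inj_on g (A - {a})"
    using g assms(2-4) by (auto simp: inj_on_def split: if_splits)
  have self: "x \<in> orbit f x" if "x \<in> A" for x
    using inj_self_in_orbit assms that by metis
  have orb: "orbit g x = orbit f x - {a}" if x: "x \<in> A - {a}" for x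
  proof (intro equalityI subsetI)
    fix y assume y: "y \<in> orbit g x"
    then have "y \<in> A - {a}" using orbit_subset_closed[OF closed x] by blast
    moreover have "y \<in> orbit f x" using y
    proof induction
      case base
      show ?case using g[OF x] by (auto intro: orbit.intros)
    next
      case (step y)
      then have "y \<in> A - {a}" using orbit_subset_closed[OF closed x] by blast
      with step(2) g[of y] show ?case by (auto intro: orbit.intros)
    qed
    ultimately show "y \<in> orbit f x - {a}" by blast
  next
    fix y assume y: "y \<in> orbit f x - {a}"
    then have "y \<in> orbit f x" by blast
    \<comment> \<open>The invariant allows for a path of \<open>f\<close> that is currently at the
      bypassed point \<open>a\<close>, where \<open>g\<close> has already jumped to
      \<open>f a\<close>.\<close>
    then have "y \<in> orbit g x \<or> y = a \<and> f a \<in> orbit g x"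
    proof induction
      case base
      show ?case using g[OF x] orbit.base[of g x] by (auto split: if_splits)
    next
      case (step y)
      from step(2) show ?case
      proof
        assume *: "y \<in> orbit g x"
        then have "y \<in> A - {a}" using orbit_subset_closed[OF closed x] by blast
        with g[of y] orbit.step[OF *] show ?thesis by (auto split: if_splits)
      qed simp
    qed
    with y show "y \<in> orbit g x" by blast
  qed
  have eq': "orbit f z = orbit f x" if "x \<in> A" "z \<in> orbit f x" for x z
  proof -
    have "x \<in> orbit f z" by (rule orbit_swap[OF self[OF that(1)] that(2)])
    then show ?thesis using that(2) orbit_trans[of _ f] by blast
  qed
  then have eq: "orbit f x = orbit f y" if "x \<in> A" "y \<in> A" "z \<in> orbit f x" "z \<in> orbit f y" for x y z
    using that by metis
  show "cycle_count f A = cycle_count g (A - {a}) + (if f a = a then 1 else 0)"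
  proof (cases "f a = a")
    case True
    then have oa: "orbit f a = {a}" by (simp add: orbit_eq_singleton_iff)
    have "orbit g x = orbit f x" if x: "x \<in> A - {a}" for x
    proof -
      have "a \<notin> orbit f x"
        using eq[of x a a] x oa self[of x] assms(4) by (metis DiffD1 DiffD2 singletonI)
      then show ?thesis using orb[OF x] by simp
    qed
    then have "orbit g ` (A - {a}) = orbit f ` (A - {a})" by (rule image_cong[OF refl])
    moreover have "orbit f ` A = insert {a} (orbit f ` (A - {a}))"
      using oa assms(4) by (metis image_insert insert_Diff)
    ultimately have "orbit f ` A = insert {a} (orbit g ` (A - {a}))" by simp
    moreover have "{a} \<notin> orbit g ` (A - {a})" using orb by auto
    ultimately show ?thesis using True assms(1) unfolding cycle_count_def by simp
  next
    case False
    have fa: "f a \<in> A - {a}" using False assms by auto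
    have "orbit f a = orbit f (f a)"
      by (rule eq[of _ _ "f a"]) (use fa assms self in \<open>auto intro: orbit.intros\<close>)
    then have "orbit f ` A = orbit f ` (A - {a})"
      using fa assms(4) by (metis image_insert insert_Diff insert_absorb image_eqI)
    moreover have "orbit g ` (A - {a}) = (\<lambda>X. X - {a}) ` orbit f ` (A - {a})"
      using orb by (simp add: image_image)
    moreover have "inj_on (\<lambda>X. X - {a}) (orbit f ` (A - {a}))"
    proof (rule inj_onI)
      fix X Y assume X: "X \<in> orbit f ` (A - {a})" and Y: "Y \<in> orbit f ` (A - {a})"
        and XY: "X - {a} = Y - {a}"
      obtain x y where "x \<in> A - {a}" "X = orbit f x" "y \<in> A - {a}" "Y = orbit f y"
        using X Y by blast
      then show "X = Y" using eq[of x y x] XY self[of x] by blast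
    qed
    ultimately show ?thesis using False unfolding cycle_count_def by (simp add: card_image)
  qed
qed

section \<open>Elimination carried out on finite tables\<close>

text \<open>The table lists the values of a map on an initial segment of indices; eliminating the
  indices below \<open>p\<close> yields the table of the first-return map and the number of cycles lost.\<close>

primrec eliminate :: "nat \<Rightarrow> nat list \<Rightarrow> nat list \<times> nat" where
  "eliminate 0 l = (l, 0)"
| "eliminate (Suc a) l = (case eliminate a l of (m, k) \<Rightarrow>
     (map (\<lambda>x. if x = a then m ! a else x) m, if m ! a = a then Suc k else k))"

lemma length_eliminate: "length (fst (eliminate p l)) = length l"
  by (induction p) (auto simp: case_prod_beta)

lemma eliminate_less:
  assumes "set l \<subseteq> {..<N}" "p \<le> length l"
  shows "set (fst (eliminate p l)) \<subseteq> {..<N}"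
  using assms(2)
proof (induction p)
  case (Suc p)
  then have "fst (eliminate p l) ! p \<in> {..<N}"
    using length_eliminate[of p l] nth_mem[of p "fst (eliminate p l)"]
    by (metis Suc_leD Suc_le_lessD subsetD)
  with Suc show ?case by (auto simp: case_prod_beta)
qed (use assms in auto)

text \<open>Repeated bypassing along the numbering \<open>e\<close>. Indices not below
  \<open>length l\<close> occur only as values; by \<open>out\<close>, points without a table entry
  never lead to an eliminated one, so their images survive.\<close>

lemma cycle_count_eliminate:
  fixes e :: "nat \<Rightarrow> 'a"
  assumes fin: "finite A" and inj: "inj_on f A" and closed: "f ` A \<subseteq> A"
    and e: "inj_on e {..<N}" "e ` {..<p} \<subseteq> A"
    and l: "set l \<subseteq> {..<N}" "length l \<le> N" "p \<le> length l"
    and f: "\<And>x. x < length l \<Longrightarrow> f (e x) = e (l ! x)"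
    and out: "\<And>x. x \<in> A - e ` {..<length l} \<Longrightarrow> f x \<notin> e ` {..<p}"
  obtains g where "g ` (A - e ` {..<p}) \<subseteq> A - e ` {..<p}"
    "\<And>x. p \<le> x \<Longrightarrow> x < length l \<Longrightarrow> g (e x) = e (fst (eliminate p l) ! x)"
    "\<And>x. x \<in> A - e ` {..<length l} \<Longrightarrow> g x = f x"
    "cycle_count f A = cycle_count g (A - e ` {..<p}) + snd (eliminate p l)"
proof -
  \<comment> \<open>Injectivity of \<open>g\<close> joins the claim because the next bypass needs
    it.\<close>
  have "\<exists>g. g ` (A - e ` {..<p}) \<subseteq> A - e ` {..<p} \<and> inj_on g (A - e ` {..<p}) \<and>
    (\<forall>x. p \<le> x \<longrightarrow> x < length l \<longrightarrow> g (e x) = e (fst (eliminate p l) ! x)) \<and>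
    (\<forall>x \<in> A - e ` {..<length l}. g x = f x) \<and>
    cycle_count f A = cycle_count g (A - e ` {..<p}) + snd (eliminate p l)"
    using e(2) l(3) out
  proof (induction p)
    case 0
    show ?case using inj closed f by (intro exI[of _ f]) auto
  next
    case (Suc p)
    let ?A = "A - e ` {..<p}" and ?m = "fst (eliminate p l)"
    have "e ` {..<p} \<subseteq> e ` {..<Suc p}" by auto
    then have "e ` {..<p} \<subseteq> A" "p \<le> length l"
      "\<And>x. x \<in> A - e ` {..<length l} \<Longrightarrow> f x \<notin> e ` {..<p}"
      using Suc.prems by (blast, simp, blast)
    from Suc.IH[OF this] obtain g where
      g: "g ` ?A \<subseteq> ?A" "inj_on g ?A"
        "\<And>x. p \<le> x \<Longrightarrow> x < length l \<Longrightarrow> g (e x) = e (?m ! x)"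
        "\<And>x. x \<in> A - e ` {..<length l} \<Longrightarrow> g x = f x"
        "cycle_count f A = cycle_count g ?A + snd (eliminate p l)"
      by blast
    define g' where "g' x = (if g x = e p then g (e p) else g x)" for x
    have lt: "?m ! x < N" if "x < length l" for x
      using eliminate_less[OF l(1), of p] Suc.prems(2) that length_eliminate[of p l]
        nth_mem[of x ?m] by (metis Suc_leD lessThan_iff subsetD)
    have ep: "e p \<in> ?A"
      using Suc.prems(1,2) l(2) inj_on_image_mem_iff[OF e(1), of p "{..<p}"] by auto
    have A: "A - e ` {..<Suc p} = ?A - {e p}"
      by (auto simp: lessThan_Suc)
    have eq: "e x = e p \<longleftrightarrow> x = p" if "x < N" for x
      using that e(1) Suc.prems(2) l(2) by (auto simp: inj_on_def)
    note bp = cycle_count_bypass[OF _ g(2,1) ep, of g', OF _ g'_def]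
    have "g (e p) = e p \<longleftrightarrow> ?m ! p = p"
      using g(3)[of p] eq[OF lt, of p] Suc.prems(2) by auto
    then have "cycle_count f A = cycle_count g' (?A - {e p}) + snd (eliminate (Suc p) l)"
      using g(5) bp(3) fin by (auto simp: case_prod_beta)
    moreover have "g' (e x) = e (fst (eliminate (Suc p) l) ! x)"
      if "Suc p \<le> x" "x < length l" for x
      using that g(3)[of x] g(3)[of p] eq[OF lt, of x]
      by (auto simp: g'_def case_prod_beta length_eliminate)
    moreover have "g' x = f x" if "x \<in> A - e ` {..<length l}" for x
      using g(4)[OF that] Suc.prems(3)[OF that] by (auto simp: g'_def)
    ultimately show ?case
      unfolding A using bp fin by (intro exI[of _ g']) auto
  qed
  then show ?thesis using that by blast
qed

section \<open>A recurrence for the polynomials of the formula\<close>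

context includes fps_syntax
begin

text \<open>This is the expansion of \<open>1 / (1 - a X) ^ (j + 1)\<close>.\<close>

definition binomial_fps :: "nat \<Rightarrow> 'a::comm_ring_1 \<Rightarrow> 'a fps" where
  "binomial_fps j a = Abs_fps (\<lambda>i. of_nat ((j + i) choose i) * a ^ i)"

lemma binomial_fps_0: "(1 - fps_const a * fps_X) * binomial_fps 0 a = 1"
proof (rule fps_ext)
  fix n show "((1 - fps_const a * fps_X) * binomial_fps 0 a) $ n = 1 $ n"
    by (cases n) (simp_all add: binomial_fps_def ring_distribs mult.assoc)
qed

text \<open>Coefficientwise this is Pascal's rule.\<close>

lemma binomial_fps_Suc: "(1 - fps_const a * fps_X) * binomial_fps (Suc j) a = binomial_fps j a"
proof (rule fps_ext)
  fix n show "((1 - fps_const a * fps_X) * binomial_fps (Suc j) a) $ n = binomial_fps j a $ n"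
    by (cases n) (simp_all add: binomial_fps_def algebra_simps mult.assoc)
qed

lemma fps_mult3_nth:
  fixes f g k :: "'a::comm_ring_1 fps"
  shows "(f * g * k) $ n = (\<Sum>(i1, i2, i3) \<in> {(i1, i2, i3). i1 + i2 + i3 = n}. f $ i1 * g $ i2 * k $ i3)"
proof -
  have "(f * g * k) $ n = (\<Sum>i1=0..n. \<Sum>i2=0..n-i1. f $ i1 * g $ i2 * k $ (n - i1 - i2))"
    by (simp add: mult.assoc fps_mult_nth sum_distrib_left)
  also have "\<dots> = (\<Sum>(i1, i2)\<in>Sigma {0..n} (\<lambda>i1. {0..n-i1}). f $ i1 * g $ i2 * k $ (n - i1 - i2))"
    by (rule sum.Sigma) auto
  also have "\<dots> = (\<Sum>(i1, i2, i3) \<in> {(i1, i2, i3). i1 + i2 + i3 = n}. f $ i1 * g $ i2 * k $ i3)"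
    by (rule sum.reindex_bij_witness[where i = "\<lambda>(i1, i2, i3). (i1, i2)"
          and j = "\<lambda>(i1, i2). (i1, i2, n - i1 - i2)"]) auto
  finally show ?thesis .
qed

text \<open>The sum over \<open>j\<close> is cut off at \<open>N\<close> to stay finite. Its
  \<open>j\<close>-th term is divisible by \<open>fps_X ^ (2 * j)\<close>, so coefficients up to
  \<open>N\<close> are those of the full series.\<close>

definition h_fps :: "nat \<Rightarrow> real poly fps" where
  "h_fps N = (\<Sum>j\<le>N. (fps_const (6 * Z) * fps_X\<^sup>2) ^ j *
     (binomial_fps j (6 * Z) * binomial_fps j ([:1 + sqrt 3:] * (2 * Z)) * binomial_fps j ([:1 - sqrt 3:] * (2 * Z))))"

lemma h_neg: "m < 0 \<Longrightarrow> h m = 0"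
  by (auto simp: h_def intro!: sum.neutral)

text \<open>The index constraint gives \<open>m - j = j + i1 + i2 + i3\<close>, so the powers of
  \<open>2 * Z\<close> can be distributed over the four indices, and for each \<open>j\<close> the
  sum becomes a coefficient of a threefold product.\<close>

lemma h_eq_nth:
  assumes "m \<le> N"
  shows "h (int m) = h_fps N $ m"
proof -
  let ?a = "6 * Z" and ?b = "[:1 + sqrt 3:] * (2 * Z)" and ?c = "[:1 - sqrt 3:] * (2 * Z)"
  let ?F = "\<lambda>j. binomial_fps j ?a * binomial_fps j ?b * binomial_fps j ?c"
  let ?I = "\<lambda>n. {(i1, i2, i3). i1 + i2 + i3 = (n::nat)}"
  let ?t = "\<lambda>j (i1, i2, i3). [:real ((j + i1) choose i1) * real ((j + i2) choose i2) * real ((j + i3) choose i3)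
       * (1 + sqrt 3) ^ i2 * (1 - sqrt 3) ^ i3 * 3 ^ (j + i1):] * (2 * Z) ^ (j + i1 + i2 + i3)"
  have fin: "finite (?I n)" for n
    by (rule finite_subset[of _ "{..n} \<times> {..n} \<times> {..n}"]) auto
  have nat_diff: "nat (int a - int b) = a - b" for a b by arith
  have "h (int m) = (\<Sum>(j, i)\<in>Sigma {j. 2 * j \<le> m} (\<lambda>j. ?I (m - 2 * j)). ?t j i)"
    unfolding h_def
    by (rule sum.cong) (auto simp: nat_diff ac_simps intro!: arg_cong[of _ _ "\<lambda>k. _ * (2 * Z) ^ k"])
  also have "\<dots> = (\<Sum>j | 2 * j \<le> m. \<Sum>i\<in>?I (m - 2 * j). ?t j i)"
    by (rule sum.Sigma[symmetric]) (auto simp: fin intro: finite_subset[of _ "{..m}"])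
  also have "\<dots> = (\<Sum>j | 2 * j \<le> m. (6 * Z) ^ j * ?F j $ (m - 2 * j))"
  proof (rule sum.cong[OF refl])
    fix j assume "j \<in> {j. 2 * j \<le> m}"
    have t: "?t j (i1, i2, i3) = (6 * Z) ^ j * (binomial_fps j ?a $ i1 * binomial_fps j ?b $ i2 * binomial_fps j ?c $ i3)"
      for i1 i2 i3
    proof -
      have "(6 * Z) = [:3:] * (2 * Z)" by (simp add: numeral_poly)
      then have *: "(6 * Z) ^ k = [:3 ^ k:] * (2 * Z) ^ k" for k
        by (simp only: power_mult_distrib poly_const_pow)
      have c: "of_nat k = [:real k:]" for k by (simp add: of_nat_poly)
      have "?t j (i1, i2, i3) = [:3 ^ j:] * (2 * Z) ^ j * ([:real ((j + i1) choose i1):] * ([:3 ^ i1:] * (2 * Z) ^ i1)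
        * ([:real ((j + i2) choose i2):] * ([:(1 + sqrt 3) ^ i2:] * (2 * Z) ^ i2))
        * ([:real ((j + i3) choose i3):] * ([:(1 - sqrt 3) ^ i3:] * (2 * Z) ^ i3)))"
        by (simp add: power_add ac_simps)
      then show ?thesis
        by (simp only: binomial_fps_def fps_nth_Abs_fps * c power_mult_distrib[of "[:_:]"] poly_const_pow)
    qed
    show "(\<Sum>i\<in>?I (m - 2 * j). ?t j i) = (6 * Z) ^ j * ?F j $ (m - 2 * j)"
      unfolding fps_mult3_nth sum_distrib_left
      by (rule sum.cong[OF refl]) (auto simp only: t[unfolded prod.case] prod.case)
  qed
  also have "\<dots> = (\<Sum>j\<le>N. if 2 * j \<le> m then (6 * Z) ^ j * ?F j $ (m - 2 * j) else 0)"
    using assms by (subst sum.inter_filter[symmetric]) (auto intro!: sum.cong)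
  also have "\<dots> = h_fps N $ m"
  proof -
    have "((fps_const ?a * fps_X\<^sup>2) ^ j * ?F j) $ m = (if 2 * j \<le> m then ?a ^ j * ?F j $ (m - 2 * j) else 0)" for j
      by (simp add: power_mult_distrib fps_const_power power_mult[symmetric] mult.assoc fps_X_power_mult_nth del: mult_pCons_left mult_pCons_right)
    then show ?thesis
      unfolding h_fps_def fps_sum_nth by simp
  qed
  finally show ?thesis .
qed

text \<open>The cubic factors as \<open>(1 - 6 z X) (1 - b X) (1 - c X)\<close> with
  \<open>b + c = 4 z\<close> and \<open>b c = - 8 z^2\<close>. Multiplication by it lowers the index
  of each threefold product by one and turns the product for \<open>j = 0\<close> into 1.\<close>

lemma h_fps_rec:
  "(1 - fps_const (10 * Z) * fps_X + fps_const (16 * Z\<^sup>2) * fps_X\<^sup>2 + fps_const (48 * Z ^ 3) * fps_X ^ 3) * h_fps (Suc N)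
    = 1 + fps_const (6 * Z) * fps_X\<^sup>2 * h_fps N"
proof -
  let ?b = "[:1 + sqrt 3:] * (2 * Z)" and ?c = "[:1 - sqrt 3:] * (2 * Z)"
  let ?l = "\<lambda>a. 1 - fps_const a * fps_X :: real poly fps"
  let ?F = "\<lambda>j. binomial_fps j (6 * Z) * binomial_fps j ?b * binomial_fps j ?c"
  let ?u = "fps_const (6 * Z) * fps_X\<^sup>2 :: real poly fps"
  have bc: "?b + ?c = 4 * Z" "?b * ?c = - 8 * Z\<^sup>2"
  proof -
    have "[:1 + sqrt 3:] + [:1 - sqrt 3:] = [:2:]" "[:1 + sqrt 3:] * [:1 - sqrt 3:] = [:- 2:]"
      by (simp_all add: algebra_simps)
    moreover have "?b + ?c = ([:1 + sqrt 3:] + [:1 - sqrt 3:]) * (2 * Z)"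
      by (rule distrib_right[symmetric])
    moreover have "?b * ?c = ([:1 + sqrt 3:] * [:1 - sqrt 3:]) * (2 * Z * (2 * Z))"
      by (simp only: ac_simps)
    ultimately have "?b + ?c = [:2:] * (2 * Z)" "?b * ?c = [:-2:] * (2 * Z * (2 * Z))"
      by (simp_all only:)
    then show "?b + ?c = 4 * Z" "?b * ?c = - 8 * Z\<^sup>2"
      by (simp_all add: numeral_poly power2_eq_square)
  qed
  have lin: "?l x * (1 - fps_const y * fps_X + fps_const z * fps_X\<^sup>2) =
      1 - fps_const (x + y) * fps_X + fps_const (x * y + z) * fps_X\<^sup>2 - fps_const (x * z) * fps_X ^ 3"
    for x y z :: "real poly"
    unfolding fps_const_mult[symmetric] fps_const_add[symmetric]
    by (simp only: algebra_simps power2_eq_square power3_eq_cube mult_1 mult_1_right)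
  have "?l (6 * Z) * (?l ?b * ?l ?c) = ?l (6 * Z) * (1 - fps_const (4 * Z) * fps_X + fps_const (- 8 * Z\<^sup>2) * fps_X\<^sup>2)"
    using lin[of ?b ?c 0] unfolding bc by simp
  also have "\<dots> = 1 - fps_const (6 * Z + 4 * Z) * fps_X + fps_const (6 * Z * (4 * Z) + - 8 * Z\<^sup>2) * fps_X\<^sup>2
     - fps_const (6 * Z * (- 8 * Z\<^sup>2)) * fps_X ^ 3"
    by (rule lin)
  also have "\<dots> = 1 - fps_const (10 * Z) * fps_X + fps_const (16 * Z\<^sup>2) * fps_X\<^sup>2 + fps_const (48 * Z ^ 3) * fps_X ^ 3"
  proof -
    have "6 * Z + 4 * Z = 10 * Z" "6 * Z * (4 * Z) + - 8 * Z\<^sup>2 = 16 * Z\<^sup>2" "6 * Z * (- 8 * Z\<^sup>2) = - (48 * Z ^ 3)"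
      by (simp_all add: numeral_poly power2_eq_square power3_eq_cube)
    then show ?thesis by (simp flip: fps_const_neg)
  qed
  finally have D: "1 - fps_const (10 * Z) * fps_X + fps_const (16 * Z\<^sup>2) * fps_X\<^sup>2 + fps_const (48 * Z ^ 3) * fps_X ^ 3
    = ?l (6 * Z) * (?l ?b * ?l ?c)" (is "?D = _") by simp
  have D0: "?D * ?F 0 = 1"
  proof -
    have "?D * ?F 0 = (?l (6 * Z) * binomial_fps 0 (6 * Z)) * ((?l ?b * binomial_fps 0 ?b) * (?l ?c * binomial_fps 0 ?c))"
      unfolding D by (simp only: ac_simps)
    then show ?thesis by (simp only: binomial_fps_0 mult_1)
  qed
  have DS: "?D * ?F (Suc j) = ?F j" for j
  proof -
    have "?D * ?F (Suc j) = (?l (6 * Z) * binomial_fps (Suc j) (6 * Z)) * ((?l ?b * binomial_fps (Suc j) ?b) * (?l ?c * binomial_fps (Suc j) ?c))"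
      unfolding D by (simp only: ac_simps)
    then show ?thesis by (simp only: binomial_fps_Suc mult.assoc)
  qed
  have "?D * h_fps (Suc N) = ?D * ?F 0 + (\<Sum>j\<le>N. ?u ^ Suc j * (?D * ?F (Suc j)))"
    unfolding h_fps_def sum.atMost_Suc_shift by (simp only: power_0 mult_1 distrib_left sum_distrib_left ac_simps)
  also have "\<dots> = 1 + ?u * h_fps N"
    unfolding D0 DS h_fps_def sum_distrib_left by (simp only: power_Suc mult.assoc)
  finally show ?thesis .
qed

text \<open>Comparison of coefficients in \<open>h_fps_rec\<close>; the constant 1 there affects
  only index 0, and the vanishing of \<open>h\<close> at negative arguments covers small
  \<open>m\<close>.\<close>

lemma h_rec:
  assumes "m > 0"
  shows "h m = 10 * Z * h (m - 1) + (6 * Z - 16 * Z\<^sup>2) * h (m - 2) - 48 * Z ^ 3 * h (m - 3)"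
proof -
  define k where "k = nat m"
  have k: "m = int k" "k > 0" using assms by (auto simp: k_def)
  let ?S = "h_fps (Suc k)"
  have shift: "(fps_X ^ i * ?S) $ k = h (m - int i)" "(fps_X ^ i * h_fps k) $ k = h (m - int i)" for i
    using h_eq_nth[of "k - i" "Suc k"] h_eq_nth[of "k - i" k] h_neg[of "m - int i"]
    by (auto simp: fps_X_power_mult_nth k(1) of_nat_diff)
  have "(?S - fps_const (10 * Z) * (fps_X ^ 1 * ?S) + fps_const (16 * Z\<^sup>2) * (fps_X ^ 2 * ?S)
      + fps_const (48 * Z ^ 3) * (fps_X ^ 3 * ?S)) $ k = (1 + fps_const (6 * Z) * (fps_X ^ 2 * h_fps k)) $ k"
    using arg_cong[OF h_fps_rec[of k], of "\<lambda>f. f $ k"]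
    by (simp add: algebra_simps del: mult_pCons_left mult_pCons_right)
  then have "h m - 10 * Z * h (m - 1) + 16 * Z\<^sup>2 * h (m - 2) + 48 * Z ^ 3 * h (m - 3) = 6 * Z * h (m - 2)"
    unfolding fps_add_nth fps_sub_nth fps_mult_left_const_nth shift
    using k(2) h_eq_nth[of k "Suc k"] k(1) by simp
  then show ?thesis by (simp add: algebra_simps del: mult_pCons_left mult_pCons_right)
qed

lemma h_0: "h 0 = 1"
  using h_eq_nth[of 0 0] by (simp add: h_fps_def binomial_fps_def)

end

section \<open>Faces under the addition of a claw\<close>

text \<open>The vertices of \<open>iterated_claw n\<close> lie on three rails running from \<open>Base\<close> through the vertices
  \<open>Subdiv k i\<close> to \<open>Root n\<close>. \<open>Up k i\<close> and \<open>Dn k i\<close> are the darts of the rail edge between levels \<open>k\<close>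
  and \<open>k + 1\<close>; \<open>Sp k i\<close> is the dart from \<open>Root k\<close> to \<open>Subdiv (k + 1) i\<close> and \<open>Sq k i\<close> its reverse.\<close>

datatype dart = Up nat nat | Dn nat nat | Sp nat nat | Sq nat nat

definition darts :: "nat \<Rightarrow> dart set" where
  "darts n = {Up k i | k i. k \<le> n \<and> i < 3} \<union> {Dn k i | k i. k \<le> n \<and> i < 3} \<union>
     {Sp k i | k i. k < n \<and> i < 3} \<union> {Sq k i | k i. k < n \<and> i < 3}"

text \<open>Adding 2 modulo 3 is a step backwards, so the two values of \<open>c\<close> give the
  two cyclic orders.\<close>

definition turn :: "bool \<Rightarrow> nat \<Rightarrow> nat" where
  "turn c i = (i + (if c then 1 else 2)) mod 3"

text \<open>The face permutation on the darts of \<open>iterated_claw n\<close>, with \<open>p\<close> acting at the root; \<open>B\<close> is the set of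
  the other vertices at which the rotation is the positive one.\<close>

fun face_step :: "nat \<Rightarrow> claw_vertex set \<Rightarrow> nat list \<Rightarrow> dart \<Rightarrow> dart" where
  "face_step n B p (Up k i) =
     (if k = n then Dn n (p ! i) else if Subdiv (Suc k) i \<in> B then Sq k i else Up (Suc k) i)"
| "face_step n B p (Dn 0 i) = Up 0 (turn (Base \<in> B) i)"
| "face_step n B p (Dn (Suc k) i) = (if Subdiv (Suc k) i \<in> B then Dn k i else Sq k i)"
| "face_step n B p (Sp k i) = (if Subdiv (Suc k) i \<in> B then Up (Suc k) i else Dn k i)"
| "face_step n B p (Sq k i) = Sp k (turn (Root k \<in> B) i)"

lemma finite_darts: "finite (darts n)"
proof -
  have "darts n \<subseteq> (\<Union>k\<le>n. \<Union>i<3. {Up k i, Dn k i, Sp k i, Sq k i})"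
    by (auto simp: darts_def)
  then show ?thesis by (rule finite_subset) auto
qed

lemma turn_less [simp]: "turn c i < 3"
  by (simp add: turn_def)

lemma less_3_cases: "(i::nat) < 3 \<longleftrightarrow> i = 0 \<or> i = 1 \<or> i = 2"
  by auto

lemma turn_inj: "i < 3 \<Longrightarrow> j < 3 \<Longrightarrow> turn c i = turn c j \<longleftrightarrow> i = j"
  by (auto simp: less_3_cases turn_def)

definition rail_perms :: "nat list list" where
  "rail_perms = [[0,1,2],[0,2,1],[1,0,2],[1,2,0],[2,0,1],[2,1,0]]"

lemma rail_perms:
  assumes "p \<in> set rail_perms"
  shows "length p = 3" "distinct p" "i < 3 \<Longrightarrow> p ! i < 3"
  using assms by (auto simp: rail_perms_def less_3_cases)

lemma face_step_closed:
  assumes "p \<in> set rail_perms"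
  shows "face_step n B p ` darts n \<subseteq> darts n"
proof (rule image_subsetI)
  fix d assume "d \<in> darts n"
  then show "face_step n B p d \<in> darts n"
    by (cases "(n, B, p, d)" rule: face_step.cases)
      (use rail_perms(3)[OF assms] in \<open>auto simp: darts_def\<close>)
qed

lemma face_step_inj:
  assumes "p \<in> set rail_perms"
  shows "inj_on (face_step n B p) (darts n)"
proof (rule inj_onI)
  fix d d' assume "d \<in> darts n" "d' \<in> darts n" "face_step n B p d = face_step n B p d'"
  then show "d = d'"
    by (cases "(n, B, p, d)" rule: face_step.cases; cases "(n, B, p, d')" rule: face_step.cases)
      (use rail_perms(1,2)[OF assms] in \<open>auto simp: darts_def nth_eq_iff_index_eq turn_inj split: if_splits\<close>)
qed

text \<open>These are the vertices other than \<open>Root n\<close>, whose rotation is replaced by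
  the permutation \<open>p\<close>.\<close>

definition inner_vertices :: "nat \<Rightarrow> claw_vertex set" where
  "inner_vertices n = {Base} \<union> Root ` {..<n} \<union> (\<lambda>(k, i). Subdiv (Suc k) i) ` ({..<n} \<times> {..<3})"

lemma finite_inner_vertices: "finite (inner_vertices n)"
  by (simp add: inner_vertices_def)

lemma inner_vertices_Suc:
  "inner_vertices (Suc n) = insert (Subdiv (Suc n) 2) (insert (Subdiv (Suc n) 1)
     (insert (Subdiv (Suc n) 0) (insert (Root n) (inner_vertices n))))"
proof -
  have "{..<Suc n} \<times> {..<3} = {..<n} \<times> {..<3} \<union> {(n, 0), (n, 1), (n, 2 :: nat)}"
    by (auto simp: less_Suc_eq less_3_cases)
  then show ?thesis
    unfolding inner_vertices_def by (auto simp: lessThan_Suc)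
qed

lemma face_step_cong:
  assumes "d \<in> darts n" "\<And>v. v \<in> inner_vertices n \<Longrightarrow> v \<in> B \<longleftrightarrow> v \<in> C"
  shows "face_step n B p d = face_step n C p d"
  using assms(1)
  by (cases "(n, B, p, d)" rule: face_step.cases)
    (auto simp: darts_def assms(2) inner_vertices_def image_iff)

section \<open>The local change of faces when one claw is added\<close>

text \<open>Local indices for the step from \<open>n\<close> to \<open>n + 1\<close>: first the twelve new darts, then the darts
  \<open>Up n i\<close> whose successor changes, and last the darts \<open>Dn n i\<close> that follow them.\<close>

definition local_dart :: "nat \<Rightarrow> nat \<Rightarrow> dart" where
  "local_dart n x = ([Sp n, Sq n, Up (Suc n), Dn (Suc n), Up n, Dn n] ! (x div 3)) (x mod 3)"

text \<open>\<open>t\<close> is the rotation at the old root, and \<open>e0\<close>,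
  \<open>e1\<close>, \<open>e2\<close> are those at the new subdivision vertices. The list stops
  after index 14 because the successors of \<open>Dn n i\<close> do not change.\<close>

definition local_table :: "bool \<Rightarrow> bool \<Rightarrow> bool \<Rightarrow> bool \<Rightarrow> nat list \<Rightarrow> nat list" where
  "local_table t e0 e1 e2 p =
     [if e0 then 6 else 15, if e1 then 7 else 16, if e2 then 8 else 17,
      turn t 0, turn t 1, turn t 2, 9 + p ! 0, 9 + p ! 1, 9 + p ! 2,
      if e0 then 15 else 3, if e1 then 16 else 4, if e2 then 17 else 5,
      if e0 then 3 else 6, if e1 then 4 else 7, if e2 then 5 else 8]"

text \<open>The returned map is a permutation of the rails only if every \<open>Up n i\<close> ends up at some \<open>Dn n j\<close>;
  otherwise the empty list is returned.\<close>

definition transition :: "nat list \<Rightarrow> bool \<Rightarrow> bool \<Rightarrow> bool \<Rightarrow> bool \<Rightarrow> nat list \<times> nat" where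
  "transition p t e0 e1 e2 = (case eliminate 12 (local_table t e0 e1 e2 p) of
     (l, k) \<Rightarrow> (if list_all (\<lambda>x. 15 \<le> x) (drop 12 l) then map (\<lambda>x. x - 15) (drop 12 l) else [], k))"

definition transitions :: "nat list \<Rightarrow> (nat list \<times> nat) list" where
  "transitions p = [transition p False False False False,
     transition p False False False True,
     transition p False False True False,
     transition p False False True True,
     transition p False True False False,
     transition p False True False True,
     transition p False True True False,
     transition p False True True True,
     transition p True False False False,
     transition p True False False True,
     transition p True False True False,
     transition p True False True True,
     transition p True True False False,
     transition p True True False True,
     transition p True True True False,
     transition p True True True True]"

definition fixed_rails :: "nat list \<Rightarrow> nat" where
  "fixed_rails p = count_list (map (\<lambda>(i, j). i = j) (zip [0, 1, 2] p)) True"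

text \<open>The value 4, impossible for three rails, flags a first component that is not a
  permutation.\<close>

definition transition_class :: "nat list \<times> nat \<Rightarrow> nat \<times> nat" where
  "transition_class x = (if fst x \<in> set rail_perms then fixed_rails (fst x) else 4, snd x)"

text \<open>The finite computation: sixteen local rotations for each of the six root permutations.
  No row contains the flag 4, and rows of one cycle type are rearrangements of each other, which is
  why only the cycle type matters.\<close>

lemma map_transition_class:
  "map transition_class (transitions [0, 1, 2]) =
     [(0, 0), (0, 0), (0, 0), (0, 0), (0, 0), (0, 0), (0, 0), (0, 0),
      (0, 0), (0, 0), (0, 0), (0, 0), (0, 0), (0, 0), (0, 0), (0, 0)]"
  "map transition_class (transitions [0, 2, 1]) =
     [(1, 0), (1, 0), (0, 1), (1, 0), (1, 0), (1, 0), (0, 1), (1, 0),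
      (1, 0), (0, 1), (1, 0), (1, 0), (1, 0), (0, 1), (1, 0), (1, 0)]"
  "map transition_class (transitions [1, 0, 2]) =
     [(1, 0), (1, 0), (1, 0), (1, 0), (0, 1), (0, 1), (1, 0), (1, 0),
      (1, 0), (1, 0), (0, 1), (0, 1), (1, 0), (1, 0), (1, 0), (1, 0)]"
  "map transition_class (transitions [1, 2, 0]) =
     [(3, 0), (1, 1), (1, 1), (1, 1), (1, 1), (1, 1), (1, 1), (3, 0),
      (0, 0), (0, 0), (0, 0), (0, 0), (0, 0), (0, 0), (0, 0), (0, 0)]"
  "map transition_class (transitions [2, 0, 1]) =
     [(0, 0), (0, 0), (0, 0), (0, 0), (0, 0), (0, 0), (0, 0), (0, 0),
      (3, 0), (1, 1), (1, 1), (1, 1), (1, 1), (1, 1), (1, 1), (3, 0)]"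
  "map transition_class (transitions [2, 1, 0]) =
     [(1, 0), (0, 1), (1, 0), (0, 1), (1, 0), (1, 0), (1, 0), (1, 0),
      (1, 0), (1, 0), (1, 0), (1, 0), (0, 1), (1, 0), (0, 1), (1, 0)]"
  by code_simp+

lemma upt_lists:
  "[0..<12] = [0, 1, 2, 3, 4, 5, 6, 7, 8, 9, 10, 11]"
  "[0..<15] = [0, 1, 2, 3, 4, 5, 6, 7, 8, 9, 10, 11, 12, 13, 14]"
  "[0..<18] = [0, 1, 2, 3, 4, 5, 6, 7, 8, 9, 10, 11, 12, 13, 14, 15, 16, 17]"
  by code_simp+

lemma local_dart_simps:
  "local_dart n 0 = Sp n 0" "local_dart n (Suc 0) = Sp n 1" "local_dart n 1 = Sp n 1" "local_dart n 2 = Sp n 2"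
  "local_dart n 3 = Sq n 0" "local_dart n 4 = Sq n 1" "local_dart n 5 = Sq n 2"
  "local_dart n 6 = Up (Suc n) 0" "local_dart n 7 = Up (Suc n) 1" "local_dart n 8 = Up (Suc n) 2"
  "local_dart n 9 = Dn (Suc n) 0" "local_dart n 10 = Dn (Suc n) 1" "local_dart n 11 = Dn (Suc n) 2"
  "local_dart n 12 = Up n 0" "local_dart n 13 = Up n 1" "local_dart n 14 = Up n 2"
  "local_dart n 15 = Dn n 0" "local_dart n 16 = Dn n 1" "local_dart n 17 = Dn n 2"
  by (simp_all add: local_dart_def)

lemma local_dart_offset:
  "i < 3 \<Longrightarrow> local_dart n (9 + i) = Dn (Suc n) i"
  "i < 3 \<Longrightarrow> local_dart n (12 + i) = Up n i"
  "i < 3 \<Longrightarrow> local_dart n (15 + i) = Dn n i"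
  "i < 3 \<Longrightarrow> local_dart n i = Sp n i"
  by (auto simp: less_3_cases local_dart_simps)

lemma inj_on_local_dart: "inj_on (local_dart n) {..<18}"
proof -
  have "distinct (map (local_dart n) [0..<18])"
    by (simp add: upt_lists local_dart_simps)
  then show ?thesis by (simp add: distinct_map atLeast0LessThan)
qed

lemma local_dart_image:
  "local_dart n ` {..<12} = darts (Suc n) - darts n"
  "local_dart n ` {..<15} = (darts (Suc n) - darts n) \<union> Up n ` {..<3}"
proof -
  have *: "local_dart n ` {..<k} = set (map (local_dart n) [0..<k])" for k
    by (simp add: atLeast0LessThan)
  have "darts (Suc n) - darts n = {Sp n i | i. i < 3} \<union> {Sq n i | i. i < 3} \<union> {Up (Suc n) i | i. i < 3} \<union> {Dn (Suc n) i | i. i < 3}"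
    by (auto simp: darts_def less_Suc_eq le_Suc_eq)
  also have "\<dots> = {Sp n 0, Sp n 1, Sp n 2, Sq n 0, Sq n 1, Sq n 2, Up (Suc n) 0, Up (Suc n) 1, Up (Suc n) 2,
      Dn (Suc n) 0, Dn (Suc n) 1, Dn (Suc n) 2}"
    by (auto simp: less_3_cases)
  finally have D: "darts (Suc n) - darts n = \<dots>" .
  show "local_dart n ` {..<12} = darts (Suc n) - darts n"
    unfolding D * by (simp add: upt_lists local_dart_simps insert_commute)
  have U: "Up n ` {..<3} = {Up n 0, Up n 1, Up n 2}" by (auto simp: less_3_cases)
  show "local_dart n ` {..<15} = (darts (Suc n) - darts n) \<union> Up n ` {..<3}"
    unfolding D * U by (simp add: upt_lists local_dart_simps) blast
qed

lemma face_step_local_dart: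
  assumes "p \<in> set rail_perms" "x < 15"
  shows "face_step (Suc n) B p (local_dart n x) = local_dart n
    (local_table (Root n \<in> B) (Subdiv (Suc n) 0 \<in> B) (Subdiv (Suc n) 1 \<in> B) (Subdiv (Suc n) 2 \<in> B) p ! x)"
proof -
  have "p ! 0 < 3" "p ! 1 < 3" "p ! 2 < 3" using rail_perms(3)[OF assms(1)] by auto
  then have "\<forall>x \<in> set [0..<15]. face_step (Suc n) B p (local_dart n x) = local_dart n
    (local_table (Root n \<in> B) (Subdiv (Suc n) 0 \<in> B) (Subdiv (Suc n) 1 \<in> B) (Subdiv (Suc n) 2 \<in> B) p ! x)"
    by (simp add: upt_lists local_table_def local_dart_simps local_dart_offset)
  then show ?thesis using assms(2) by simp
qed

text \<open>Removing the twelve new darts leaves exactly \<open>darts n\<close>. The first-return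
  map follows \<open>q\<close> on each \<open>Up n i\<close> and is the old face step elsewhere;
  \<open>k\<close> counts the faces made of new darts only.\<close>

lemma cycle_count_face_step_Suc:
  assumes p: "p \<in> set rail_perms" and q: "q \<in> set rail_perms"
    and tr: "transition p (Root n \<in> B) (Subdiv (Suc n) 0 \<in> B) (Subdiv (Suc n) 1 \<in> B) (Subdiv (Suc n) 2 \<in> B) = (q, k)"
  shows "cycle_count (face_step (Suc n) B p) (darts (Suc n)) = cycle_count (face_step n B q) (darts n) + k"
proof -
  let ?f = "face_step (Suc n) B p" and ?e = "local_dart n"
  define l where "l = local_table (Root n \<in> B) (Subdiv (Suc n) 0 \<in> B) (Subdiv (Suc n) 1 \<in> B) (Subdiv (Suc n) 2 \<in> B) p"
  have len: "length l = 15" by (simp add: l_def local_table_def)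
  have p3: "p ! 0 < 3" "p ! 1 < 3" "p ! 2 < 3" using rail_perms(3)[OF p] by auto
  have set_l: "set l \<subseteq> {..<18}"
    using p3 less_trans[OF turn_less, of 18 "Root n \<in> B"] by (auto simp: l_def local_table_def)
  define m where "m = fst (eliminate 12 l)"
  \<comment> \<open>The failing branch of \<open>transition\<close> returns the empty list, which
    \<open>q \<noteq> []\<close> rules out.\<close>
  have if_eq: "b \<and> q = x \<and> k = k'" if "(if b then x else [], k') = (q, k)" "q \<noteq> []" for b x k'
    using that by (cases b) auto
  have "q \<noteq> []" using rail_perms(1)[OF q] by auto
  then have m_k: "list_all (\<lambda>x. 15 \<le> x) (drop 12 m) \<and> q = map (\<lambda>x. x - 15) (drop 12 m) \<and> k = snd (eliminate 12 l)"
    using tr unfolding transition_def l_def[symmetric] m_def case_prod_beta by (intro if_eq)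
  note m = m_k[THEN conjunct1] m_k[THEN conjunct2, THEN conjunct1]
    and k = m_k[THEN conjunct2, THEN conjunct2]
  have len_m: "length m = 15" by (simp add: m_def length_eliminate len)
  \<comment> \<open>Index \<open>12 + i\<close> is \<open>Up n i\<close>, and index
    \<open>15 + q ! i\<close> is \<open>Dn n (q ! i)\<close>. The lower bound 15 keeps the
    subtraction exact.\<close>
  have m_nth: "m ! (12 + i) = 15 + q ! i" if "i < 3" for i
    using m(1) that len_m unfolding m(2) by (auto simp: list_all_length)
  have stay: "?f x = face_step n B q x" "?f x \<in> darts n" if x: "x \<in> darts (Suc n) - ?e ` {..<15}" for x
  proof -
    have x': "x \<in> darts n" "x \<notin> Up n ` {..<3}" using x unfolding local_dart_image by auto
    show eq: "?f x = face_step n B q x"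
      using x' by (cases "(n, B, q, x)" rule: face_step.cases) (auto simp: darts_def)
    show "?f x \<in> darts n" unfolding eq using face_step_closed[OF q] x'(1) by blast
  qed
  have val: "?f (?e x) = ?e (l ! x)" if "x < length l" for x
    using face_step_local_dart[OF p] that len unfolding l_def by metis
  have out: "?f x \<notin> ?e ` {..<12}" if "x \<in> darts (Suc n) - ?e ` {..<length l}" for x
    using stay(2)[of x] that unfolding len local_dart_image(1) by blast
  have sub: "?e ` {..<12} \<subseteq> darts (Suc n)" "length l \<le> 18" "12 \<le> length l"
    using local_dart_image(1) len by auto
  obtain g where g: "g ` (darts (Suc n) - ?e ` {..<12}) \<subseteq> darts (Suc n) - ?e ` {..<12}"
    "\<And>x. 12 \<le> x \<Longrightarrow> x < length l \<Longrightarrow> g (?e x) = ?e (m ! x)"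
    "\<And>x. x \<in> darts (Suc n) - ?e ` {..<length l} \<Longrightarrow> g x = ?f x"
    "cycle_count ?f (darts (Suc n)) = cycle_count g (darts (Suc n) - ?e ` {..<12}) + k"
    unfolding m_def k
    by (rule cycle_count_eliminate[OF finite_darts face_step_inj[OF p] face_step_closed[OF p]
          inj_on_local_dart sub(1) set_l sub(2,3) val out]) blast+
  have "darts n \<subseteq> darts (Suc n)" by (auto simp: darts_def)
  then have A: "darts (Suc n) - ?e ` {..<12} = darts n"
    unfolding local_dart_image by blast
  have "g d = face_step n B q d" if d: "d \<in> darts n" for d
  proof (cases "d \<in> Up n ` {..<3}")
    case True
    then obtain i where i: "d = Up n i" "i < 3" by auto
    then have "g d = ?e (m ! (12 + i))" using g(2)[of "12 + i"] len by (simp add: local_dart_offset)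
    then show ?thesis using i rail_perms(3)[OF q] by (simp add: m_nth local_dart_offset)
  next
    case False
    then have "d \<in> darts (Suc n) - ?e ` {..<15}"
      using d \<open>darts n \<subseteq> darts (Suc n)\<close> unfolding local_dart_image by blast
    then show ?thesis using stay(1) g(3) len by simp
  qed
  then show ?thesis
    using g(1,4) cycle_count_cong[of g "darts n" "face_step n B q"] unfolding A by simp
qed

section \<open>Transfer recursion for the face-counting polynomials\<close>

definition toggle :: "bool \<Rightarrow> 'a \<Rightarrow> 'a set \<Rightarrow> 'a set" where
  "toggle b x B = (if b then insert x B else B)"

lemma sum_Pow_insert:
  assumes "finite S" "x \<notin> S"
  shows "(\<Sum>B\<in>Pow (insert x S). f B) = (\<Sum>B\<in>Pow S. f (toggle False x B) + f (toggle True x B))"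
proof -
  have "inj_on (insert x) (Pow S)" using assms(2) by (auto simp: inj_on_def)
  moreover have "Pow S \<inter> insert x ` Pow S = {}" using assms(2) by auto
  ultimately show ?thesis
    using assms(1) by (simp add: Pow_insert sum.union_disjoint sum.reindex sum.distrib toggle_def)
qed

text \<open>This is \<open>P\<^sub>n(p)\<close> of the overview; here \<open>Z\<close> marks faces
  and not genus.\<close>

definition face_poly :: "nat \<Rightarrow> nat list \<Rightarrow> real poly" where
  "face_poly n p = (\<Sum>B\<in>Pow (inner_vertices n). Z ^ cycle_count (face_step n B p) (darts n))"

text \<open>The sets of new inner vertices split according to the rotations at the old root and the
  three subdivision vertices. \<open>toggle\<close> writes both halves of each split in one form, so
  a single argument covers all sixteen cases.\<close>

lemma face_poly_Suc:
  assumes p: "p \<in> set rail_perms" and tr: "fst ` set (transitions p) \<subseteq> set rail_perms"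
  shows "face_poly (Suc n) p = (\<Sum>x\<leftarrow>transitions p. Z ^ snd x * face_poly n (fst x))"
proof -
  let ?r = "Root n" and ?s = "Subdiv (Suc n)"
  let ?T = "\<lambda>B. Z ^ cycle_count (face_step (Suc n) B p) (darts (Suc n))"
  let ?W = "\<lambda>x B. Z ^ snd x * Z ^ cycle_count (face_step n B (fst x)) (darts n)"
  have fresh: "?r \<notin> inner_vertices n" "?s i \<notin> inner_vertices n" for i
    by (auto simp: inner_vertices_def)
  have step: "?T (toggle e2 (?s 2) (toggle e1 (?s 1) (toggle e0 (?s 0) (toggle t ?r B))))
      = ?W (transition p t e0 e1 e2) B" if B: "B \<in> Pow (inner_vertices n)" for t e0 e1 e2 B
  proof -
    let ?x = "transition p t e0 e1 e2"
    let ?C = "toggle e2 (?s 2) (toggle e1 (?s 1) (toggle e0 (?s 0) (toggle t ?r B)))"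
    have mem: "?r \<in> ?C \<longleftrightarrow> t" "?s 0 \<in> ?C \<longleftrightarrow> e0" "?s 1 \<in> ?C \<longleftrightarrow> e1" "?s 2 \<in> ?C \<longleftrightarrow> e2"
      using B fresh by (auto simp: toggle_def)
    have "?x \<in> set (transitions p)"
      by (cases t; cases e0; cases e1; cases e2) (simp_all only: transitions_def list.set insert_iff simp_thms)
    then have q: "fst ?x \<in> set rail_perms" using tr by blast
    have "cycle_count (face_step (Suc n) ?C p) (darts (Suc n)) = cycle_count (face_step n ?C (fst ?x)) (darts n) + snd ?x"
      by (rule cycle_count_face_step_Suc[OF p q]) (simp only: mem prod.collapse)
    \<comment> \<open>The four toggled vertices are not in \<open>inner_vertices n\<close>, so the
      old face step ignores them.\<close>
    also have "cycle_count (face_step n ?C (fst ?x)) (darts n) = cycle_count (face_step n B (fst ?x)) (darts n)"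
      using face_step_closed[OF q] B fresh
      by (intro cycle_count_cong face_step_cong) (auto simp: toggle_def)
    finally show ?thesis by (simp only: power_add mult.commute)
  qed
  have "face_poly (Suc n) p = (\<Sum>B\<in>Pow (inner_vertices n). \<Sum>x\<leftarrow>transitions p. ?W x B)"
    unfolding face_poly_def inner_vertices_Suc
    by (simp add: sum_Pow_insert finite_inner_vertices fresh transitions_def step ac_simps
      del: Pow_insert One_nat_def)
  also have "\<dots> = (\<Sum>x\<leftarrow>transitions p. Z ^ snd x * face_poly n (fst x))"
    unfolding transitions_def face_poly_def sum_distrib_left by (simp add: sum.distrib)
  finally show ?thesis .
qed

text \<open>The second argument is the number of fixed points of the root permutation: 3 for the identity,
  1 for a transposition, 0 for a 3-cycle.\<close>

fun class_poly :: "nat \<Rightarrow> nat \<Rightarrow> real poly" where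
  "class_poly 0 c = (if c = 3 then 2 * Z else if c = 1 then 2 * Z\<^sup>2 else Z ^ 3 + Z)"
| "class_poly (Suc n) c =
     (if c = 3 then 16 * class_poly n 0
      else if c = 1 then 12 * class_poly n 1 + 4 * Z * class_poly n 0
      else 2 * class_poly n 3 + 6 * Z * class_poly n 1 + 8 * class_poly n 0)"

text \<open>Indices 0 to 2 stand for \<open>Up 0 i\<close> and 3 to 5 for
  \<open>Dn 0 i\<close>.\<close>

definition base_table :: "bool \<Rightarrow> nat list \<Rightarrow> nat list" where
  "base_table b p = [3 + p ! 0, 3 + p ! 1, 3 + p ! 2, turn b 0, turn b 1, turn b 2]"

text \<open>Eliminating all six darts leaves the empty set, so the tally of lost cycles is the full
  face count.\<close>

lemma cycle_count_face_step_0: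
  assumes p: "p \<in> set rail_perms"
  shows "cycle_count (face_step 0 B p) (darts 0) = snd (eliminate 6 (base_table (Base \<in> B) p))"
proof -
  define e where "e x = (if x < 3 then Up 0 x else Dn 0 (x - 3))" for x
  have upt: "[0..<6] = [0, 1, 2, 3, 4, 5]" by (simp add: upt_rec)
  have img: "e ` {..<k} = set (map e [0..<k])" for k by (simp add: atLeast0LessThan)
  have p3: "p ! 0 < 3" "p ! 1 < 3" "p ! 2 < 3" using rail_perms(3)[OF p] by auto
  have "darts 0 = {Up 0 0, Up 0 1, Up 0 2, Dn 0 0, Dn 0 1, Dn 0 2}"
    by (auto simp: darts_def less_3_cases)
  then have A: "e ` {..<6} = darts 0"
    unfolding img upt by (simp add: e_def)
  have "distinct (map e [0..<6])" unfolding upt by (simp add: e_def)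
  then have inj: "inj_on e {..<6}" by (simp add: distinct_map atLeast0LessThan)
  have len: "length (base_table b p) = 6" for b by (simp add: base_table_def)
  have "set (base_table b p) \<subseteq> {..<6}" for b
    using p3 less_trans[OF turn_less, of 6 b] by (auto simp: base_table_def)
  moreover have "face_step 0 B p (e x) = e (base_table (Base \<in> B) p ! x)" if "x < 6" for x
  proof -
    have "\<forall>x\<in>set [0..<6]. face_step 0 B p (e x) = e (base_table (Base \<in> B) p ! x)"
      unfolding upt using p3 by (simp add: e_def base_table_def)
    then show ?thesis using that by simp
  qed
  ultimately obtain g where "cycle_count (face_step 0 B p) (darts 0) =
      cycle_count g (darts 0 - e ` {..<6}) + snd (eliminate 6 (base_table (Base \<in> B) p))"
    by (rule_tac cycle_count_eliminate[OF finite_darts face_step_inj[OF p] face_step_closed[OF p] inj,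
          where p = 6 and l = "base_table (Base \<in> B) p"]) (auto simp: A len)
  then show ?thesis unfolding A by (simp add: cycle_count_def)
qed

lemma face_poly_0:
  assumes "p \<in> set rail_perms"
  shows "face_poly 0 p = class_poly 0 (fixed_rails p)"
proof -
  have "map (\<lambda>p. (fixed_rails p, snd (eliminate 6 (base_table False p)), snd (eliminate 6 (base_table True p)))) rail_perms
    = [(3, 1, 1), (1, 2, 2), (1, 2, 2), (0, 3, 1), (0, 1, 3), (1, 2, 2)]"
    unfolding rail_perms_def list.map by code_simp
  then have "(fixed_rails p, snd (eliminate 6 (base_table False p)), snd (eliminate 6 (base_table True p)))
    \<in> {(3, 1, 1), (1, 2, 2), (0, 3, 1), (0, 1, 3)}"
    using assms unfolding rail_perms_def by auto
  moreover have "face_poly 0 p = Z ^ snd (eliminate 6 (base_table False p)) + Z ^ snd (eliminate 6 (base_table True p))"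
    unfolding face_poly_def inner_vertices_def
    by (simp add: sum_Pow_insert cycle_count_face_step_0[OF assms] toggle_def del: Pow_insert)
  ultimately show ?thesis by (auto simp: numeral_poly)
qed

text \<open>In the induction step, the rows of \<open>map_transition_class\<close> add up to the
  three recurrences that define \<open>class_poly\<close>.\<close>

lemma face_poly_eq_class_poly:
  assumes "p \<in> set rail_perms"
  shows "face_poly n p = class_poly n (fixed_rails p)"
  using assms
proof (induction n arbitrary: p)
  case 0
  then show ?case by (rule face_poly_0)
next
  case (Suc n)
  have fr: "map fixed_rails rail_perms = [3, 1, 1, 0, 0, 1]" by code_simp
  \<comment> \<open>Absence of the flag 4 means that all sixteen transitions are permutations of the
    rails, as \<open>face_poly_Suc\<close> requires.\<close>
  have "4 \<notin> fst ` set (map transition_class (transitions p))"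
    using Suc.prems by (auto simp: rail_perms_def map_transition_class simp del: set_map One_nat_def)
  then have sub: "fst ` set (transitions p) \<subseteq> set rail_perms"
    by (force simp: transition_class_def)
  have "face_poly (Suc n) p = (\<Sum>x\<leftarrow>transitions p. Z ^ snd x * face_poly n (fst x))"
    by (rule face_poly_Suc[OF Suc.prems sub])
  also have "\<dots> = (\<Sum>x\<leftarrow>transitions p. Z ^ snd (transition_class x) * class_poly n (fst (transition_class x)))"
    using sub Suc.IH by (intro arg_cong[of _ _ sum_list] map_cong) (auto simp: transition_class_def)
  also have "\<dots> = (\<Sum>x\<leftarrow>map transition_class (transitions p). Z ^ snd x * class_poly n (fst x))"
    by (simp add: comp_def)
  also have "\<dots> = class_poly (Suc n) (fixed_rails p)"
    using Suc.prems fr by (auto simp: rail_perms_def map_transition_class algebra_simps simp del: map_map One_nat_def)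
  finally show ?case .
qed

section \<open>Rotation systems of the iterated claws\<close>

text \<open>A fixed point or a swapped pair would form a proper subset closed under
  \<open>f\<close>, and a cyclic map admits no nonempty one; only the two 3-cycles remain.\<close>

lemma cyclic_on_3_iff:
  assumes "distinct [x, y, z]"
  shows "cyclic_on f {x, y, z} \<longleftrightarrow> f x = y \<and> f y = z \<and> f z = x \<or> f x = z \<and> f z = y \<and> f y = x"
proof
  have orbit3: "orbit f a = {a, b, c}" if "f a = b" "f b = c" "f c = a" for a b c
  proof
    show "orbit f a \<subseteq> {a, b, c}" using that by (intro orbit_subset_closed) auto
    have "b \<in> orbit f a" using orbit.base[of f a] that by simp
    moreover from this have "c \<in> orbit f a" using orbit.step that by metis
    moreover from this have "a \<in> orbit f a" using orbit.step that by metis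
    ultimately show "{a, b, c} \<subseteq> orbit f a" by simp
  qed
  {
    assume "f x = y \<and> f y = z \<and> f z = x \<or> f x = z \<and> f z = y \<and> f y = x"
    then have "orbit f x = {x, y, z}" using orbit3[of x y z] orbit3[of x z y] by auto
    then show "cyclic_on f {x, y, z}" unfolding cyclic_on_def by blast
  }
  assume cyc: "cyclic_on f {x, y, z}"
  have closed: "{x, y, z} \<subseteq> A" if "f ` A \<subseteq> A" "a \<in> A" "a \<in> {x, y, z}" for a A
    using orbit_subset_closed[OF that(1,2)] cyc that(3) by (simp only: cyclic_on_alldef)
  have "f a \<in> {x, y, z}" if "a \<in> {x, y, z}" for a
  proof -
    have "{x, y, z} = orbit f a" using cyc that by (simp only: cyclic_on_alldef)
    then show ?thesis using orbit.base[of f a] by simp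
  qed
  then have "f x \<in> {x, y, z}" "f y \<in> {x, y, z}" "f z \<in> {x, y, z}" by blast+
  moreover have "f a \<noteq> a" if "a \<in> {x, y, z}" "b \<in> {x, y, z}" "b \<noteq> a" for a b
  proof
    assume "f a = a"
    then have "{x, y, z} \<subseteq> {a}" by (intro closed[of "{a}" a] that(1)) simp_all
    then show False using that by blast
  qed
  from this[of x y] this[of y z] this[of z x] have "f x \<noteq> x" "f y \<noteq> y" "f z \<noteq> z"
    using assms by auto
  moreover have "\<not> (f a = b \<and> f b = a)" if "a \<in> {x, y, z}" "c \<in> {x, y, z}" "c \<noteq> a" "c \<noteq> b" for a b c
  proof
    assume "f a = b \<and> f b = a"
    then have "{x, y, z} \<subseteq> {a, b}" by (intro closed[of "{a, b}" a] that(1)) simp_all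
    then show False using that by blast
  qed
  from this[of x z y] this[of y x z] this[of x y z]
  have "\<not> (f x = y \<and> f y = x)" "\<not> (f y = z \<and> f z = y)" "\<not> (f x = z \<and> f z = x)"
    using assms by auto
  ultimately show "f x = y \<and> f y = z \<and> f z = x \<or> f x = z \<and> f z = y \<and> f y = x"
    by (simp only: insert_iff empty_iff) metis
qed

lemma turn_values:
  "turn True 0 = 1" "turn True 1 = 2" "turn True 2 = 0"
  "turn False 0 = 2" "turn False 1 = 0" "turn False 2 = 1"
  by (simp_all add: turn_def)

text \<open>In a cubic graph with ports \<open>a v 0, a v 1, a v 2\<close> at each vertex \<open>v\<close>, a set \<open>B\<close> of vertices
  selects the rotation in which precisely the vertices in \<open>B\<close> turn in the order of the ports.\<close>

definition cubic_rotation :: "('v, 'e) pre_digraph \<Rightarrow> ('v \<Rightarrow> nat \<Rightarrow> 'e) \<Rightarrow> 'v set \<Rightarrow> 'e \<Rightarrow> 'e" where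
  "cubic_rotation G a B x = (if x \<in> arcs G
     then a (tail G x) (turn (tail G x \<in> B) (the_inv_into {..<3} (a (tail G x)) x)) else x)"

lemma cubic_rotation_apply:
  assumes "arcs G = (\<Union>v\<in>verts G. a v ` {..<3})" "\<And>v j. v \<in> verts G \<Longrightarrow> j < 3 \<Longrightarrow> tail G (a v j) = v"
    "\<And>v. v \<in> verts G \<Longrightarrow> inj_on (a v) {..<3}" "v \<in> verts G" "j < 3"
  shows "cubic_rotation G a B (a v j) = a v (turn (v \<in> B) j)"
proof -
  have "a v j \<in> arcs G" unfolding assms(1) using assms(4,5) by blast
  then show ?thesis
    using assms by (simp add: cubic_rotation_def the_inv_into_f_f)
qed

text \<open>At each vertex there are exactly two cyclic orders of the ports, and the choices at
  different vertices are independent.\<close>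

lemma bij_betw_cubic_rotation:
  assumes fin: "finite (verts G)" and arcs: "arcs G = (\<Union>v\<in>verts G. a v ` {..<3})"
    and tail: "\<And>v j. v \<in> verts G \<Longrightarrow> j < 3 \<Longrightarrow> tail G (a v j) = v"
    and inj: "\<And>v. v \<in> verts G \<Longrightarrow> inj_on (a v) {..<3}"
  shows "bij_betw (cubic_rotation G a) (Pow (verts G)) {\<rho>. rotation_system G \<rho>}"
proof -
  let ?R = "cubic_rotation G a"
  have app: "?R B (a v j) = a v (turn (v \<in> B) j)" if "v \<in> verts G" "j < 3" for B v j
    by (rule cubic_rotation_apply[OF arcs]) (use tail inj that in auto)
  have out: "out_arcs G v = {a v 0, a v 1, a v 2}" if "v \<in> verts G" for v
  proof -
    have "out_arcs G v = a v ` {..<3}"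
      using that tail by (auto simp: out_arcs_def arcs)
    then show ?thesis by (auto simp: less_3_cases image_iff)
  qed
  have dist: "distinct [a v 0, a v 1, a v 2]" if "v \<in> verts G" for v
    using inj_on_eq_iff[OF inj[OF that], of 0 1] inj_on_eq_iff[OF inj[OF that], of 0 2]
      inj_on_eq_iff[OF inj[OF that], of 1 2] by simp
  have eq: "a v i = a w j \<longleftrightarrow> v = w \<and> i = j" if "v \<in> verts G" "w \<in> verts G" "i < 3" "j < 3" for v w i j
    using tail[of v i] tail[of w j] inj[of v] that by (auto simp: inj_on_def)
  have fin_arcs: "finite (arcs G)" unfolding arcs using fin by simp
  have rot: "rotation_system G (?R B)" for B
    unfolding rotation_system_def
  proof (intro conjI ballI impI)
    have "inj_on (?R B) (arcs G)"
      unfolding arcs by (auto simp: inj_on_def app eq turn_inj)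
    moreover have "?R B ` arcs G \<subseteq> arcs G"
      unfolding arcs by (auto simp: app)
    ultimately have "bij_betw (?R B) (arcs G) (arcs G)"
      using fin_arcs by (simp add: bij_betw_def endo_inj_surj)
    then show "?R B permutes arcs G"
      by (rule bij_imp_permutes) (simp add: cubic_rotation_def)
    fix v assume v: "v \<in> verts G"
    show "cyclic_on (?R B) (out_arcs G v)"
      unfolding out[OF v] cyclic_on_3_iff[OF dist[OF v]]
      by (cases "v \<in> B") (simp_all add: app v turn_values del: One_nat_def)
  qed
  have "inj_on ?R (Pow (verts G))"
  proof (rule inj_onI)
    fix B C assume B: "B \<in> Pow (verts G)" and C: "C \<in> Pow (verts G)" and BC: "?R B = ?R C"
    have "v \<in> B \<longleftrightarrow> v \<in> C" if v: "v \<in> verts G" for v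
    proof -
      have "a v (turn (v \<in> B) 0) = a v (turn (v \<in> C) 0)"
        using app[OF v, of 0 B] app[OF v, of 0 C] BC by simp
      then show ?thesis using eq[OF v v] by (auto simp: turn_def split: if_splits)
    qed
    then show "B = C" using B C by blast
  qed
  moreover have "\<rho> \<in> ?R ` Pow (verts G)" if \<rho>: "rotation_system G \<rho>" for \<rho>
  proof
    \<comment> \<open>The image of port 0 alone tells the two cyclic orders apart.\<close>
    define B where "B = {v \<in> verts G. \<rho> (a v 0) = a v 1}"
    show "B \<in> Pow (verts G)" by (auto simp: B_def)
    show "\<rho> = ?R B"
    proof
      fix x
      show "\<rho> x = ?R B x"
      proof (cases "x \<in> arcs G")
        case True
        then obtain v j where x: "x = a v j" "v \<in> verts G" "j < 3" unfolding arcs by blast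
        have "cyclic_on \<rho> {a v 0, a v 1, a v 2}"
          using \<rho> x(2) out[OF x(2)] unfolding rotation_system_def by (metis insert_not_empty)
        then have "\<rho> (a v 0) = a v 1 \<and> \<rho> (a v 1) = a v 2 \<and> \<rho> (a v 2) = a v 0 \<or>
            \<rho> (a v 0) = a v 2 \<and> \<rho> (a v 2) = a v 1 \<and> \<rho> (a v 1) = a v 0"
          unfolding cyclic_on_3_iff[OF dist[OF x(2)]] .
        moreover have "a v 1 \<noteq> a v 2" using dist[OF x(2)] by simp
        moreover have "v \<in> B \<longleftrightarrow> \<rho> (a v 0) = a v 1" using x(2) by (simp add: B_def)
        ultimately have "\<rho> (a v j) = a v (turn (v \<in> B) j)"
          using x(3) unfolding less_3_cases by (auto simp: turn_values simp del: One_nat_def)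
        then show ?thesis using app[OF x(2,3)] x(1) by simp
      next
        case False
        then show ?thesis
          using \<rho> permutes_not_in[of \<rho> "arcs G" x] by (simp add: rotation_system_def cubic_rotation_def)
      qed
    qed
  qed
  then have "?R ` Pow (verts G) = {\<rho>. rotation_system G \<rho>}" using rot by blast
  ultimately show ?thesis unfolding bij_betw_def ..
qed

section \<open>Darts as arcs of the iterated claws\<close>

definition rail_vertex :: "nat \<Rightarrow> nat \<Rightarrow> nat \<Rightarrow> claw_vertex" where
  "rail_vertex n k i = (if k = 0 then Base else if k = Suc n then Root n else Subdiv k i)"

text \<open>The map depends on \<open>n\<close> because level \<open>n + 1\<close> of all three
  rails is the current root, where the next claw puts subdivision vertices.\<close>

fun arc_of_dart :: "nat \<Rightarrow> dart \<Rightarrow> claw_vertex larc" where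
  "arc_of_dart n (Up k i) = (rail_vertex n k i, rail_vertex n (Suc k) i, i)"
| "arc_of_dart n (Dn k i) = (rail_vertex n (Suc k) i, rail_vertex n k i, i)"
| "arc_of_dart n (Sp k i) = (Root k, Subdiv (Suc k) i, i)"
| "arc_of_dart n (Sq k i) = (Subdiv (Suc k) i, Root k, i)"

lemma arc_of_dart_root:
  assumes "d \<in> darts n"
  shows "fst (arc_of_dart n d) = Root n \<longleftrightarrow> d \<in> Dn n ` {..<3}"
    "fst (snd (arc_of_dart n d)) = Root n \<longleftrightarrow> d \<in> Up n ` {..<3}"
  using assms by (auto simp: darts_def rail_vertex_def split: if_splits)

lemma root_arcs_of_darts:
  "{a \<in> arc_of_dart n ` darts n. fst a = Root n} = arc_of_dart n ` Dn n ` {..<3}"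
proof -
  have "Dn n ` {..<3} \<subseteq> darts n" by (auto simp: darts_def)
  then show ?thesis using arc_of_dart_root(1)[of _ n] by blast
qed

text \<open>When a root edge is subdivided, its outer half keeps the darts \<open>Up n i\<close> and
  \<open>Dn n i\<close>. The half at the old root becomes \<open>Sp n i\<close> and
  \<open>Sq n i\<close>, and the edge to the new root carries \<open>Up (Suc n) i\<close> and
  \<open>Dn (Suc n) i\<close>.\<close>

lemma arcs_iterated_claw: "arcs (iterated_claw n) = arc_of_dart n ` darts n"
proof (induction n)
  case 0
  have "darts 0 = {Up 0 0, Up 0 1, Up 0 2, Dn 0 0, Dn 0 1, Dn 0 2}"
    by (auto simp: darts_def less_3_cases)
  then show ?case
    by (auto simp: lgraph_def edge_def rail_vertex_def)
next
  case (Suc n)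
  let ?G = "iterated_claw n" and ?x = "Subdiv (Suc n)" and ?e = "arc_of_dart (Suc n)"
  have out: "out_arcs ?G (Root n) = arc_of_dart n ` Dn n ` {..<3}"
    unfolding out_arcs_def iterated_claw_tail_head Suc.IH by (rule root_arcs_of_darts)
  have old: "arcs ?G - out_arcs ?G (Root n) - in_arcs ?G (Root n) = arc_of_dart n ` (darts n - Dn n ` {..<3} - Up n ` {..<3})"
    unfolding out_arcs_def in_arcs_def iterated_claw_tail_head Suc.IH comp_apply
    using arc_of_dart_root[of _ n] by auto
  have same: "arc_of_dart n d = ?e d" if "d \<in> darts n - Dn n ` {..<3} - Up n ` {..<3}" for d
    using that by (auto simp: darts_def rail_vertex_def)
  have "(\<Union>(_, w, i)\<in>out_arcs ?G (Root n). edge (Root n) (?x i) i \<union> edge (?x i) w i \<union> edge (?x i) (Root (Suc n)) i)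
    = (\<Union>i<3. {?e (Sp n i), ?e (Sq n i)} \<union> {?e (Dn n i), ?e (Up n i)} \<union> {?e (Up (Suc n) i), ?e (Dn (Suc n) i)})"
    unfolding out image_image UN_simps by (cases n) (simp_all add: edge_def rail_vertex_def)
  also have "\<dots> = ?e ` (\<Union>i<3. {Sp n i, Sq n i, Dn n i, Up n i, Up (Suc n) i, Dn (Suc n) i})"
    unfolding image_UN by (intro SUP_cong refl) auto
  finally have new: "(\<Union>(_, w, i)\<in>out_arcs ?G (Root n). edge (Root n) (?x i) i \<union> edge (?x i) w i \<union> edge (?x i) (Root (Suc n)) i)
    = \<dots>" .
  have "darts (Suc n) = (darts n - Dn n ` {..<3} - Up n ` {..<3}) \<union>
      (\<Union>i<3. {Sp n i, Sq n i, Dn n i, Up n i, Up (Suc n) i, Dn (Suc n) i})"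
  proof (rule set_eqI)
    fix d
    show "d \<in> darts (Suc n) \<longleftrightarrow> d \<in> (darts n - Dn n ` {..<3} - Up n ` {..<3}) \<union>
      (\<Union>i<3. {Sp n i, Sq n i, Dn n i, Up n i, Up (Suc n) i, Dn (Suc n) i})"
      by (cases d) (auto simp: darts_def)
  qed
  moreover have "arc_of_dart n ` (darts n - Dn n ` {..<3} - Up n ` {..<3}) = ?e ` (darts n - Dn n ` {..<3} - Up n ` {..<3})"
    by (rule image_cong[OF refl same])
  ultimately have "?e ` darts (Suc n) = arc_of_dart n ` (darts n - Dn n ` {..<3} - Up n ` {..<3}) \<union>
      ?e ` (\<Union>i<3. {Sp n i, Sq n i, Dn n i, Up n i, Up (Suc n) i, Dn (Suc n) i})"
    by (simp only: image_Un)
  then show ?case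
    unfolding iterated_claw.simps add_claw_def old new by (simp add: lgraph_def)
qed

lemma verts_iterated_claw: "verts (iterated_claw n) = insert (Root n) (inner_vertices n)"
proof (induction n)
  case 0
  show ?case by (auto simp: lgraph_def inner_vertices_def)
next
  case (Suc n)
  have "out_arcs (iterated_claw n) (Root n) = arc_of_dart n ` Dn n ` {..<3}"
    unfolding out_arcs_def iterated_claw_tail_head arcs_iterated_claw by (rule root_arcs_of_darts)
  then have "{Subdiv (Suc n) i | i w. (Root n, w, i) \<in> out_arcs (iterated_claw n) (Root n)} = Subdiv (Suc n) ` {..<3}"
    by (auto simp: rail_vertex_def image_iff)
  also have "\<dots> = {Subdiv (Suc n) 0, Subdiv (Suc n) 1, Subdiv (Suc n) 2}"
    by (auto simp: less_3_cases)
  finally show ?case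
    unfolding iterated_claw.simps add_claw_def inner_vertices_Suc Suc.IH by (auto simp: lgraph_def)
qed

lemma arc_of_dart_inj: "inj_on (arc_of_dart n) (darts n)"
proof (rule inj_onI)
  fix d e assume "d \<in> darts n" "e \<in> darts n" "arc_of_dart n d = arc_of_dart n e"
  then show "d = e"
    by (cases d; cases e) (auto simp: darts_def rail_vertex_def split: if_splits)
qed

text \<open>The order down, spoke, up at a subdivision vertex matches the positive rotation built
  into \<open>face_step\<close>. In the iterated claws such vertices have \<open>k > 0\<close>, so
  \<open>k - 1\<close> does not truncate.\<close>

fun port :: "nat \<Rightarrow> claw_vertex \<Rightarrow> nat \<Rightarrow> dart" where
  "port n Base j = Up 0 j"
| "port n (Root k) j = (if k = n then Dn n j else Sp k j)"
| "port n (Subdiv k i) j = (if j = 0 then Dn (k - 1) i else if j = 1 then Sq (k - 1) i else Up k i)"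

lemma ports_iterated_claw:
  defines "G \<equiv> \<lambda>n. iterated_claw n"
  shows "arcs (G n) = (\<Union>v\<in>verts (G n). (\<lambda>j. arc_of_dart n (port n v j)) ` {..<3})"
    and "v \<in> verts (G n) \<Longrightarrow> j < 3 \<Longrightarrow> tail (G n) (arc_of_dart n (port n v j)) = v"
    and "v \<in> verts (G n) \<Longrightarrow> inj_on (\<lambda>j. arc_of_dart n (port n v j)) {..<3}"
proof -
  have mem: "port n v j \<in> darts n" if "v \<in> verts (G n)" "j < 3" for v j
  proof -
    consider "j = 0" | "j = 1" | "j = 2" using \<open>j < 3\<close> unfolding less_3_cases by blast
    then show ?thesis
      by cases (use that(1) in \<open>auto simp: G_def verts_iterated_claw inner_vertices_def darts_def\<close>)
  qed
  have "\<exists>v\<in>verts (G n). \<exists>j<3. d = port n v j" if d: "d \<in> darts n" for d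
  proof (cases d)
    case (Up k i)
    show ?thesis
    proof (cases k)
      case 0
      then show ?thesis using Up d unfolding G_def verts_iterated_claw
        by (intro bexI[of _ Base] exI[of _ i]) (auto simp: inner_vertices_def darts_def)
    next
      case (Suc k')
      then show ?thesis using Up d unfolding G_def verts_iterated_claw
        by (intro bexI[of _ "Subdiv k i"] exI[of _ 2]) (auto simp: inner_vertices_def darts_def image_iff)
    qed
  next
    case (Dn k i)
    show ?thesis
    proof (cases "k = n")
      case True
      then show ?thesis using Dn d unfolding G_def verts_iterated_claw
        by (intro bexI[of _ "Root n"] exI[of _ i]) (auto simp: darts_def)
    next
      case False
      then show ?thesis using Dn d unfolding G_def verts_iterated_claw
        by (intro bexI[of _ "Subdiv (Suc k) i"] exI[of _ 0]) (auto simp: inner_vertices_def darts_def image_iff)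
    qed
  next
    case (Sp k i)
    then show ?thesis using d unfolding G_def verts_iterated_claw
      by (intro bexI[of _ "Root k"] exI[of _ i]) (auto simp: inner_vertices_def darts_def)
  next
    case (Sq k i)
    then show ?thesis using d unfolding G_def verts_iterated_claw
      by (intro bexI[of _ "Subdiv (Suc k) i"] exI[of _ 1]) (auto simp: inner_vertices_def darts_def image_iff)
  qed
  then have "darts n = (\<Union>v\<in>verts (G n). port n v ` {..<3})"
    using mem by blast
  then show "arcs (G n) = (\<Union>v\<in>verts (G n). (\<lambda>j. arc_of_dart n (port n v j)) ` {..<3})"
    unfolding G_def arcs_iterated_claw by (simp add: image_UN image_image)
  show "tail (G n) (arc_of_dart n (port n v j)) = v" if "v \<in> verts (G n)" "j < 3"
    using that unfolding G_def iterated_claw_tail_head verts_iterated_claw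
    by (auto simp: inner_vertices_def rail_vertex_def)
  have "inj_on (port n v) {..<3}" for v
    by (cases v) (auto simp: inj_on_def less_3_cases)
  then show "inj_on (\<lambda>j. arc_of_dart n (port n v j)) {..<3}" if "v \<in> verts (G n)"
    using comp_inj_on[of "port n v" "{..<3}" "arc_of_dart n"] mem[OF that] inj_on_subset[OF arc_of_dart_inj, of "port n v ` {..<3}" n]
    by (auto simp: comp_def image_subset_iff)
qed

section \<open>From faces to genus\<close>

text \<open>The substitution of \<open>y^(-2)\<close> for \<open>z\<close> is not polynomial, so it
  is made on values, \<open>w\<close> being \<open>y^(-2)\<close>. The coupled recurrences of the
  three cycle types force a joint induction, in which \<open>h_rec\<close> reduces the claims for
  3-cycles and transpositions to polynomial identities.\<close>

lemma poly_class_poly: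
  fixes y w :: real
  assumes yw: "y\<^sup>2 * w = 1"
  defines "H \<equiv> \<lambda>m. poly (h m) w"
  shows "2 * poly (class_poly n 0) y =
      y ^ (2 * n + 3) * 2 ^ n / 2 * (H (int n + 1) + 2 * (2 - 3 * w) * H (int n) - 6 * w * H (int n - 1))"
    and "poly (class_poly n 1) y =
      y ^ (2 * n + 2) * 2 ^ n * (2 * H (int n) + (2 - 6 * w) * H (int n - 1) - 12 * w\<^sup>2 * H (int n - 2))"
    and "poly (class_poly n 3) y =
      y ^ (2 * n + 1) * 2 ^ n * 2 * (H (int n) + 2 * (2 - 3 * w) * H (int n - 1) - 6 * w * H (int n - 2))"
proof (induction n)
  case 0
  have H: "H 0 = 1" "H 1 = 10 * w" "m < 0 \<Longrightarrow> H m = 0" for m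
    using h_rec[of 1] by (simp_all add: H_def h_0 h_neg)
  have "y ^ 3 * w = y" using yw by (simp add: power2_eq_square power3_eq_cube)
  then have "2 * (y ^ 3 + y) = y ^ 3 / 2 * (10 * w + 2 * (2 - 3 * w))" by (simp add: field_simps)
  then show "2 * poly (class_poly 0 0) y = y ^ (2 * 0 + 3) * 2 ^ 0 / 2 * (H (int 0 + 1) + 2 * (2 - 3 * w) * H (int 0) - 6 * w * H (int 0 - 1))"
    by (simp add: H)
  show "poly (class_poly 0 1) y = y ^ (2 * 0 + 2) * 2 ^ 0 * (2 * H (int 0) + (2 - 6 * w) * H (int 0 - 1) - 12 * w\<^sup>2 * H (int 0 - 2))"
    "poly (class_poly 0 3) y = y ^ (2 * 0 + 1) * 2 ^ 0 * 2 * (H (int 0) + 2 * (2 - 3 * w) * H (int 0 - 1) - 6 * w * H (int 0 - 2))"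
    by (simp_all add: H power2_eq_square)
next
  case (Suc n)
  have rec: "H m = 10 * w * H (m - 1) + (6 * w - 16 * w\<^sup>2) * H (m - 2) - 48 * w ^ 3 * H (m - 3)" if "m > 0" for m
    using h_rec[OF that] by (simp add: H_def)
  define a b c d where "a = H (int n + 1)" and "b = H (int n)" and "c = H (int n - 1)" and "d = H (int n - 2)"
  have a: "a = 10 * w * b + (6 * w - 16 * w\<^sup>2) * c - 48 * w ^ 3 * d"
    using rec[of "int n + 1"] by (simp add: a_def b_def c_def d_def)
  have e: "H (int n + 2) = 10 * w * a + (6 * w - 16 * w\<^sup>2) * b - 48 * w ^ 3 * c"
    using rec[of "int n + 2"] by (simp add: a_def b_def c_def add.commute)
  have shift: "H (int (Suc n) + 1) = H (int n + 2)" "H (int (Suc n)) = a" "H (int (Suc n) - 1) = b" "H (int (Suc n) - 2) = c"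
    by (simp_all add: a_def b_def c_def add.commute)
  have exps: "2 * Suc n + 1 = 2 * n + 3" "2 * Suc n + 2 = 2 * n + 4" "2 * Suc n + 3 = 2 * n + 5"
    by simp_all
  \<comment> \<open>This is the power of \<open>y\<close> in the new 3-cycle claim; the lower odd
    powers are \<open>Y\<close> times powers of \<open>w\<close>, so no division by \<open>y\<close>
    occurs.\<close>
  define Y where "Y = y ^ (2 * n + 5)"
  have Y: "y ^ (2 * n + 3) = w * Y" "y ^ (2 * n + 2) * y = w * Y" "y ^ (2 * n + 1) = w\<^sup>2 * Y"
  proof -
    have "Y = y ^ ((2 * n + 1) + 2 + 2)" "Y = y ^ ((2 * n + 3) + 2)"
      unfolding Y_def by (rule arg_cong[of _ _ "power y"]; simp)+
    then have "Y = y ^ (2 * n + 1) * y\<^sup>2 * y\<^sup>2" "Y = y ^ (2 * n + 3) * y\<^sup>2"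
      by (simp_all only: power_add)
    then have "w * Y = y ^ (2 * n + 3) * (y\<^sup>2 * w)"
        "w\<^sup>2 * Y = y ^ (2 * n + 1) * (y\<^sup>2 * w) * (y\<^sup>2 * w)"
      by (simp_all only: power2_eq_square ac_simps)
    then have 3: "y ^ (2 * n + 3) = w * Y" and 1: "y ^ (2 * n + 1) = w\<^sup>2 * Y"
      unfolding yw by simp_all
    show "y ^ (2 * n + 3) = w * Y" "y ^ (2 * n + 1) = w\<^sup>2 * Y" by (fact 3, fact 1)
    show "y ^ (2 * n + 2) * y = w * Y" unfolding 3[symmetric] power_Suc2[symmetric] by (rule arg_cong[of _ _ "power y"]) simp
  qed
  have Y2: "y ^ (2 * n + 4) * w = y ^ (2 * n + 2)" "y ^ (2 * n + 3) * y = y ^ (2 * n + 4)"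
  proof -
    have "y ^ (2 * n + 4) = y ^ ((2 * n + 2) + 2)" by (rule arg_cong[of _ _ "power y"]) simp
    then show "y ^ (2 * n + 4) * w = y ^ (2 * n + 2)" using yw by (simp only: power_add mult.assoc mult_1_right)
    show "y ^ (2 * n + 3) * y = y ^ (2 * n + 4)"
      unfolding power_Suc2[symmetric] by (rule arg_cong[of _ _ "power y"]) simp
  qed
  note IH = Suc.IH[folded a_def b_def c_def d_def]
  show "poly (class_poly (Suc n) 3) y =
      y ^ (2 * Suc n + 1) * 2 ^ Suc n * 2 * (H (int (Suc n)) + 2 * (2 - 3 * w) * H (int (Suc n) - 1) - 6 * w * H (int (Suc n) - 2))"
    unfolding shift exps using IH(1) by (simp add: numeral_poly)
  have "poly (class_poly (Suc n) 1) y = 12 * poly (class_poly n 1) y + 2 * y * (2 * poly (class_poly n 0) y)"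
    by (simp add: numeral_poly)
  also have "\<dots> = 12 * (y ^ (2 * n + 4) * w) * 2 ^ n * (2 * b + (2 - 6 * w) * c - 12 * w\<^sup>2 * d) +
     2 ^ n * (y ^ (2 * n + 3) * y) * (a + 2 * (2 - 3 * w) * b - 6 * w * c)"
    unfolding IH(1,2) Y2(1) by (simp add: ac_simps)
  also have "\<dots> = 2 ^ n * y ^ (2 * n + 4) * (12 * w * (2 * b + (2 - 6 * w) * c - 12 * w\<^sup>2 * d) + (a + 2 * (2 - 3 * w) * b - 6 * w * c))"
    unfolding Y2(2) by (simp add: algebra_simps)
  also have "12 * w * (2 * b + (2 - 6 * w) * c - 12 * w\<^sup>2 * d) + (a + 2 * (2 - 3 * w) * b - 6 * w * c)
    = 2 * (2 * a + (2 - 6 * w) * b - 12 * w\<^sup>2 * c)"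
    using a by algebra
  finally show "poly (class_poly (Suc n) 1) y =
      y ^ (2 * Suc n + 2) * 2 ^ Suc n * (2 * H (int (Suc n)) + (2 - 6 * w) * H (int (Suc n) - 1) - 12 * w\<^sup>2 * H (int (Suc n) - 2))"
    unfolding shift exps by (simp add: ac_simps)
  have "2 * poly (class_poly (Suc n) 0) y = 4 * poly (class_poly n 3) y + 12 * y * poly (class_poly n 1) y + 8 * (2 * poly (class_poly n 0) y)"
    by (simp add: numeral_poly)
  also have "\<dots> = 4 * (w\<^sup>2 * Y * 2 ^ n * 2 * (b + 2 * (2 - 3 * w) * c - 6 * w * d)) +
      12 * ((y ^ (2 * n + 2) * y) * 2 ^ n * (2 * b + (2 - 6 * w) * c - 12 * w\<^sup>2 * d)) +
      8 * (w * Y * 2 ^ n / 2 * (a + 2 * (2 - 3 * w) * b - 6 * w * c))"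
    unfolding IH Y(1,3) by (simp only: ac_simps)
  also have "\<dots> = Y * 2 ^ n * (8 * w\<^sup>2 * (b + 2 * (2 - 3 * w) * c - 6 * w * d) +
      12 * w * (2 * b + (2 - 6 * w) * c - 12 * w\<^sup>2 * d) + 4 * w * (a + 2 * (2 - 3 * w) * b - 6 * w * c))"
    unfolding Y(2) by (simp add: algebra_simps)
  also have "8 * w\<^sup>2 * (b + 2 * (2 - 3 * w) * c - 6 * w * d) +
      12 * w * (2 * b + (2 - 6 * w) * c - 12 * w\<^sup>2 * d) + 4 * w * (a + 2 * (2 - 3 * w) * b - 6 * w * c)
    = H (int n + 2) + 2 * (2 - 3 * w) * a - 6 * w * b"
    using a unfolding e by algebra
  finally show "2 * poly (class_poly (Suc n) 0) y = y ^ (2 * Suc n + 3) * 2 ^ Suc n / 2 *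
      (H (int (Suc n) + 1) + 2 * (2 - 3 * w) * H (int (Suc n)) - 6 * w * H (int (Suc n) - 1))"
    unfolding shift exps Y_def by (simp add: ac_simps)
qed

text \<open>A polynomial in the number of faces is the reversal of one in the genus.\<close>

lemma coeff_reversed:
  fixes P Q :: "real poly"
  assumes "\<And>y w. y\<^sup>2 * w = 1 \<Longrightarrow> poly Q y = y ^ N * poly P w"
  shows "coeff P g = (if 2 * g \<le> N then coeff Q (N - 2 * g) else 0)"
proof -
  \<comment> \<open>Large enough to bound the degree of \<open>P\<close> and to reach
    \<open>g\<close>; the factor \<open>y ^ (2 * d)\<close> clears the negative powers of
    \<open>y\<close>.\<close>
  define d where "d = degree P + g"
  define R where "R = (\<Sum>i\<le>d. monom (coeff P i) (N + 2 * (d - i)))"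
  have "poly (monom 1 (2 * d) * Q) y = poly R y" if "y \<noteq> 0" for y
  proof -
    define w where "w = 1 / y\<^sup>2"
    have yw: "y\<^sup>2 * w = 1" using that by (simp add: w_def)
    have "poly P w = (\<Sum>i\<le>d. coeff P i * w ^ i)"
      unfolding poly_altdef by (rule sum.mono_neutral_left) (auto simp: d_def coeff_eq_0)
    moreover have "y ^ (2 * d) * w ^ i = y ^ (2 * (d - i))" if "i \<le> d" for i
    proof -
      have "y ^ (2 * d) = y ^ (2 * (d - i)) * (y\<^sup>2) ^ i"
        using that by (simp flip: power_mult power_add add: algebra_simps)
      then show ?thesis using yw by (simp add: mult.assoc flip: power_mult_distrib)
    qed
    ultimately have "y ^ (2 * d) * poly P w = (\<Sum>i\<le>d. coeff P i * y ^ (2 * (d - i)))"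
      by (simp add: sum_distrib_left mult.left_commute[of "y ^ _"])
    then have "y ^ (2 * d) * poly Q y = (\<Sum>i\<le>d. coeff P i * y ^ (N + 2 * (d - i)))"
      unfolding assms[OF yw] by (simp add: sum_distrib_left power_add mult.left_commute)
    then show ?thesis by (simp add: R_def poly_sum poly_monom)
  qed
  then have "\<forall>y\<in>{0<..}. poly (monom 1 (2 * d) * Q - R) y = 0" by auto
  moreover have "infinite {0::real<..}" by (simp add: infinite_Ioi)
  ultimately have "\<not> finite {y. poly (monom 1 (2 * d) * Q - R) y = 0}"
    using finite_subset[of "{0::real<..}" "{y. poly (monom 1 (2 * d) * Q - R) y = 0}"] by fast
  then have "monom 1 (2 * d) * Q - R = 0"
    using poly_roots_finite by blast
  \<comment> \<open>This position is \<open>2 * d + N - 2 * g\<close>. If \<open>2 * g > N\<close>,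
    it lies below degree \<open>2 * d\<close>, where the left product has no terms.\<close>
  then have "coeff (monom 1 (2 * d) * Q) (N + 2 * (d - g)) = coeff R (N + 2 * (d - g))" by simp
  moreover have "coeff R (N + 2 * (d - g)) = (\<Sum>i\<le>d. if i = g then coeff P i else 0)"
    unfolding R_def coeff_sum by (rule sum.cong) (auto simp: d_def)
  ultimately show ?thesis
    by (auto simp: coeff_monom_mult d_def)
qed

section \<open>Numbers of vertices and arcs\<close>

lemma card_inner_vertices: "card (inner_vertices n) = 4 * n + 1"
proof (induction n)
  case 0
  show ?case by (simp add: inner_vertices_def)
next
  case (Suc n)
  have "Root n \<notin> inner_vertices n" "Subdiv (Suc n) i \<notin> inner_vertices n" for i
    by (auto simp: inner_vertices_def)
  then show ?case
    using Suc.IH by (simp add: inner_vertices_Suc finite_inner_vertices)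
qed

lemma Root_notin_inner_vertices: "Root n \<notin> inner_vertices n"
  by (auto simp: inner_vertices_def)

lemma card_verts_iterated_claw: "card (verts (iterated_claw n)) = 4 * n + 2"
  by (simp add: verts_iterated_claw finite_inner_vertices Root_notin_inner_vertices card_inner_vertices)

lemma card_arcs_iterated_claw: "card (arcs (iterated_claw n)) = 12 * n + 6"
proof -
  let ?a = "\<lambda>v j. arc_of_dart n (port n v j)"
  have "card (arcs (iterated_claw n)) = (\<Sum>v\<in>verts (iterated_claw n). card (?a v ` {..<3}))"
    unfolding ports_iterated_claw(1)
  proof (rule card_UN_disjoint)
    show "finite (verts (iterated_claw n))"
      by (simp add: verts_iterated_claw finite_inner_vertices)
    show "\<forall>v\<in>verts (iterated_claw n). \<forall>w\<in>verts (iterated_claw n). v \<noteq> w \<longrightarrow> ?a v ` {..<3} \<inter> ?a w ` {..<3} = {}"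
    proof (intro ballI impI equals0I)
      fix v w x assume "v \<in> verts (iterated_claw n)" "w \<in> verts (iterated_claw n)" "v \<noteq> w"
        "x \<in> ?a v ` {..<3} \<inter> ?a w ` {..<3}"
      then show False using ports_iterated_claw(2)[of v n] ports_iterated_claw(2)[of w n] by force
    qed
  qed simp
  also have "\<dots> = (\<Sum>v\<in>verts (iterated_claw n). 3)"
    using ports_iterated_claw(3) by (intro sum.cong refl) (simp add: card_image)
  finally show ?thesis by (simp add: card_verts_iterated_claw)
qed

section \<open>Faces as cycles of the face step\<close>

fun dart_rev :: "dart \<Rightarrow> dart" where
  "dart_rev (Up k i) = Dn k i"
| "dart_rev (Dn k i) = Up k i"
| "dart_rev (Sp k i) = Sq k i"
| "dart_rev (Sq k i) = Sp k i"

text \<open>These two 3-cycles are the root permutations that come from genuine rotations.\<close>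

definition root_perm :: "bool \<Rightarrow> nat list" where
  "root_perm b = (if b then [1, 2, 0] else [2, 0, 1])"

lemma root_perm_nth: "i < 3 \<Longrightarrow> root_perm b ! i = turn b i"
  by (cases b) (auto simp: less_3_cases root_perm_def turn_def)

text \<open>A face step reverses the dart and then turns at the vertex \<open>v\<close> from which
  the reversed dart leaves.\<close>

lemma face_step_port:
  assumes "d \<in> darts n"
  obtains v j where "v \<in> verts (iterated_claw n)" "j < 3" "dart_rev d = port n v j"
    "face_step n B (root_perm (Root n \<in> B)) d = port n v (turn (v \<in> B) j)"
proof (cases d)
  case (Up k i)
  show ?thesis
  proof (cases "k = n")
    case True
    then show ?thesis using Up assms
      by (intro that[of "Root n" i]) (auto simp: verts_iterated_claw darts_def root_perm_nth)
  next
    case False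
    then show ?thesis using Up assms
      by (intro that[of "Subdiv (Suc k) i" 0])
        (auto simp: verts_iterated_claw inner_vertices_def darts_def image_iff turn_def)
  qed
next
  case (Dn k i)
  show ?thesis
  proof (cases k)
    case 0
    then show ?thesis using Dn assms
      by (intro that[of Base i]) (auto simp: verts_iterated_claw inner_vertices_def darts_def)
  next
    case (Suc k')
    then show ?thesis using Dn assms
      by (intro that[of "Subdiv k i" 2])
        (auto simp: verts_iterated_claw inner_vertices_def darts_def image_iff turn_def)
  qed
next
  case (Sp k i)
  then show ?thesis using assms
    by (intro that[of "Subdiv (Suc k) i" 1])
      (auto simp: verts_iterated_claw inner_vertices_def darts_def image_iff turn_def)
next
  case (Sq k i)
  then show ?thesis using assms
    by (intro that[of "Root k" i]) (auto simp: verts_iterated_claw inner_vertices_def darts_def)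
qed

definition claw_rotation :: "nat \<Rightarrow> claw_vertex set \<Rightarrow> claw_vertex larc \<Rightarrow> claw_vertex larc" where
  "claw_rotation n = cubic_rotation (iterated_claw n) (\<lambda>v j. arc_of_dart n (port n v j))"

lemma card_faces_claw_rotation:
  "card (faces (iterated_claw n) (arc_rev (iterated_claw n)) (claw_rotation n B)) =
    cycle_count (face_step n B (root_perm (Root n \<in> B))) (darts n)"
proof -
  let ?G = "iterated_claw n" and ?e = "arc_of_dart n"
  have "root_perm b \<in> set rail_perms" for b by (simp add: root_perm_def rail_perms_def)
  moreover have "(claw_rotation n B \<circ> arc_rev ?G) (?e d) = ?e (face_step n B (root_perm (Root n \<in> B)) d)"
    if d: "d \<in> darts n" for d
  proof -
    have "?e d \<in> arcs ?G" using d by (simp add: arcs_iterated_claw)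
    then have "arc_rev ?G (?e d) = arc_swap (?e d)" by (simp add: arc_rev_def)
    also have "\<dots> = ?e (dart_rev d)" by (cases d) (simp_all add: arc_swap_def)
    finally have "arc_rev ?G (?e d) = ?e (dart_rev d)" .
    moreover obtain v j where "v \<in> verts ?G" "j < 3" "dart_rev d = port n v j"
      "face_step n B (root_perm (Root n \<in> B)) d = port n v (turn (v \<in> B) j)"
      by (rule face_step_port[OF d])
    moreover have "claw_rotation n B (?e (port n v j)) = ?e (port n v (turn (v \<in> B) j))"
      if "v \<in> verts ?G" "j < 3" for v j
      unfolding claw_rotation_def
      by (rule cubic_rotation_apply[OF ports_iterated_claw(1)]) (use that ports_iterated_claw(2,3) in auto)
    ultimately show ?thesis by simp
  qed
  ultimately have "cycle_count (claw_rotation n B \<circ> arc_rev ?G) (?e ` darts n) =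
      cycle_count (face_step n B (root_perm (Root n \<in> B))) (darts n)"
    by (intro cycle_count_conj[OF arc_of_dart_inj face_step_closed]) auto
  then show ?thesis by (simp add: faces_def cycle_count_def arcs_iterated_claw)
qed

lemma bij_betw_claw_rotation:
  "bij_betw (claw_rotation n) (Pow (verts (iterated_claw n))) {\<rho>. rotation_system (iterated_claw n) \<rho>}"
  unfolding claw_rotation_def
  by (rule bij_betw_cubic_rotation[OF _ ports_iterated_claw(1)])
    (use ports_iterated_claw(2,3) in \<open>auto simp: verts_iterated_claw finite_inner_vertices\<close>)

text \<open>With \<open>4 n + 2\<close> vertices and \<open>6 n + 3\<close> edges, Euler's formula
  makes genus \<open>g\<close> equivalent to \<open>2 n + 3 - 2 g\<close> faces. The case
  distinction guards the truncated subtraction.\<close>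

lemma card_embeddings_iterated_claw:
  "real (card (embeddings_of_genus (iterated_claw n) (arc_rev (iterated_claw n)) g)) =
    (if 2 * g \<le> 2 * n + 3 then coeff (2 * class_poly n 0) (2 * n + 3 - 2 * g) else 0)"
proof -
  let ?G = "iterated_claw n"
  let ?V = "verts ?G"
  let ?F = "\<lambda>B. cycle_count (face_step n B (root_perm (Root n \<in> B))) (darts n)"
  have fin: "finite (Pow ?V)" by (simp add: verts_iterated_claw finite_inner_vertices)
  have "euler_characteristic ?G (arc_rev ?G) (claw_rotation n B) = 2 - 2 * int g \<longleftrightarrow> ?F B + 2 * g = 2 * n + 3" for B
    unfolding euler_characteristic_def card_faces_claw_rotation card_verts_iterated_claw card_arcs_iterated_claw
    by (simp add: zdiv_int) linarith
  note euler = this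
  have R: "{\<rho>. rotation_system ?G \<rho>} = claw_rotation n ` Pow ?V"
    using bij_betw_claw_rotation[of n] by (simp add: bij_betw_def)
  have "embeddings_of_genus ?G (arc_rev ?G) g =
      {\<rho> \<in> {\<rho>. rotation_system ?G \<rho>}. euler_characteristic ?G (arc_rev ?G) \<rho> = 2 - 2 * int g}"
    by (simp add: embeddings_of_genus_def)
  also have "\<dots> = claw_rotation n ` {B \<in> Pow ?V. euler_characteristic ?G (arc_rev ?G) (claw_rotation n B) = 2 - 2 * int g}"
    unfolding R by blast
  finally have "embeddings_of_genus ?G (arc_rev ?G) g = claw_rotation n ` {B \<in> Pow ?V. ?F B + 2 * g = 2 * n + 3}"
    unfolding euler .
  moreover have "inj_on (claw_rotation n) {B \<in> Pow ?V. ?F B + 2 * g = 2 * n + 3}"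
    by (rule inj_on_subset[OF bij_betw_imp_inj_on[OF bij_betw_claw_rotation]]) blast
  ultimately have card: "card (embeddings_of_genus ?G (arc_rev ?G) g) = card {B \<in> Pow ?V. ?F B + 2 * g = 2 * n + 3}"
    by (simp only: card_image)
  \<comment> \<open>Membership of \<open>Root n\<close> in \<open>B\<close> acts only through
    \<open>root_perm\<close>; with the permutation fixed it changes nothing.\<close>
  have "face_step n (insert (Root n) B) p d = face_step n B p d" if "d \<in> darts n" for B p d
    using that Root_notin_inner_vertices[of n] by (intro face_step_cong) auto
  then have ins: "cycle_count (face_step n (insert (Root n) B) p) (darts n) = cycle_count (face_step n B p) (darts n)"
    if "p \<in> set rail_perms" for B p
    using face_step_closed[OF that] by (intro cycle_count_cong) auto
  \<comment> \<open>The two rotations at the root give one 3-cycle each, hence twice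
    \<open>class_poly n 0\<close>.\<close>
  have "(\<Sum>B\<in>Pow ?V. Z ^ ?F B) = (\<Sum>B\<in>Pow (inner_vertices n).
      Z ^ cycle_count (face_step n B [2, 0, 1]) (darts n) + Z ^ cycle_count (face_step n B [1, 2, 0]) (darts n))"
    unfolding verts_iterated_claw sum_Pow_insert[OF finite_inner_vertices Root_notin_inner_vertices]
    using Root_notin_inner_vertices[of n]
    by (intro sum.cong refl) (auto simp: toggle_def root_perm_def rail_perms_def ins)
  also have "\<dots> = face_poly n [2, 0, 1] + face_poly n [1, 2, 0]"
    by (simp add: face_poly_def sum.distrib)
  also have "\<dots> = 2 * class_poly n 0"
  proof -
    have "fixed_rails [2, 0, 1] = 0" "fixed_rails [1, 2, 0] = 0" by code_simp+
    then show ?thesis by (simp add: face_poly_eq_class_poly rail_perms_def)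
  qed
  finally have sum: "(\<Sum>B\<in>Pow ?V. Z ^ ?F B) = 2 * class_poly n 0" .
  have "coeff (\<Sum>B\<in>Pow ?V. Z ^ ?F B) m = real (card {B \<in> Pow ?V. ?F B = m})" for m
  proof -
    have "coeff (\<Sum>B\<in>Pow ?V. Z ^ ?F B) m = (\<Sum>B\<in>Pow ?V. if ?F B = m then 1 else 0)"
      by (simp add: coeff_sum monom_altdef[of 1, simplified, symmetric] del: One_nat_def)
    also have "\<dots> = real (card {B \<in> Pow ?V. ?F B = m})"
      using fin by (simp add: sum.If_cases Int_def)
    finally show ?thesis .
  qed
  then show ?thesis
    unfolding card sum by (auto intro!: arg_cong[of _ _ card] simp: le_imp_diff_is_add)
qed

theorem theorem3p2:
  fixes n :: nat
  shows "genus_polynomial (iterated_claw n) (arc_rev (iterated_claw n)) =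
    [:2 powi (int n - 1):] *
      (h (int n + 1) + 2 * (2 - 3 * Z) * h (int n) - 6 * Z * h (int n - 1))"
proof (rule poly_eqI)
  fix g
  let ?P = "[:2 powi (int n - 1):] * (h (int n + 1) + 2 * (2 - 3 * Z) * h (int n) - 6 * Z * h (int n - 1))"
  have "poly (2 * class_poly n 0) y = y ^ (2 * n + 3) * poly ?P w" if "y\<^sup>2 * w = 1" for y w
  proof -
    \<comment> \<open>For \<open>n = 0\<close> the exponent is negative, so the factor is written as
      \<open>2 ^ n / 2\<close>.\<close>
    have two: "2 powi (int n - 1) = (2 ^ n / 2 :: real)" by (simp add: power_int_diff)
    have "poly ?P w = 2 powi (int n - 1) * (poly (h (int n + 1)) w + 2 * (2 - 3 * w) * poly (h (int n)) w - 6 * w * poly (h (int n - 1)) w)"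
      by (simp add: numeral_poly algebra_simps)
    then show ?thesis using poly_class_poly(1)[OF that, of n] unfolding two by (simp add: numeral_poly)
  qed
  \<comment> \<open>Both sides are the coefficient of \<open>2 * class_poly n 0\<close> at
    \<open>2 * n + 3 - 2 * g\<close>, or 0 if that index would be negative.\<close>
  from coeff_reversed[OF this]
  show "coeff (genus_polynomial (iterated_claw n) (arc_rev (iterated_claw n))) g = coeff ?P g"
    using fin_digraph.finite_arcs[OF fin_digraph_iterated_claw, of n]
    by (simp only: coeff_genus_polynomial card_embeddings_iterated_claw)
qed

end
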